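(* Let $\{|\psi_\lambda\rangle=|\alpha_\lambda\rangle|\beta_\lambda\rangle,p_\lambda\}_{\lambda=1}^3$ with $p_\lambda>0$ be a linearly independent ensemble of two-qubit product states whose span is $\{|\Phi\rangle\}^\perp$ for a unit vector $|\Phi\rangle$. Let $\lambda_{min}(\Phi)$ be the smallest squared Schmidt coefficient of $|\Phi\rangle$. If $$p_i^2\lambda_{min}^2(\Phi)>p_j^2|\langle\psi_i|\psi_j\rangle|^2+p_k^2|\langle\psi_i|\psi_k\rangle|^2$$ for every $i,j,k$ with $\{i,j,k\}=\{1,2,3\}$, then no LOCC measurement attains the optimal minimum-error success probability for the ensemble.
   Context: $\{|\Phi\rangle\}^\perp$ is the orthogonal complement of $|\Phi\rangle$ in $\mathbb{C}^2\otimes\mathbb{C}^2$. The optimal minimum-error success probability of $\{|\psi_i\rangle,p_i\}_{i=1}^n$ is the maximum over $n$-outcome POVMs $\{\Pi_i\}$ of $\sum_ip_i\langle\psi_i|\Pi_i|\psi_i\rangle$. LOCC means measurements implementable by local operations on each qubit and classical communication. *)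

theory Defs
  imports Complex_Main "Jordan_Normal_Form.Char_Poly"
begin

(* Conventions: C^2 (x) C^2 = C^4 with basis |a>|b> ~ index 2*a+b.
   Vectors/operators are Jordan_Normal_Form vec/mat over complex. *)

definition braket :: "complex vec \<Rightarrow> complex vec \<Rightarrow> complex" where
  "braket u v = (\<Sum>i<dim_vec u. cnj (u $ i) * v $ i)"

definition adj :: "complex mat \<Rightarrow> complex mat" where
  "adj A = mat (dim_col A) (dim_row A) (\<lambda>(i,j). cnj (A $$ (j,i)))"

definition tensor_vec :: "complex vec \<Rightarrow> complex vec \<Rightarrow> complex vec" where
  "tensor_vec a b = vec (dim_vec a * dim_vec b)
     (\<lambda>i. a $ (i div dim_vec b) * b $ (i mod dim_vec b))"

definition kron :: "complex mat \<Rightarrow> complex mat \<Rightarrow> complex mat" where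
  "kron A B = mat (dim_row A * dim_row B) (dim_col A * dim_col B)
     (\<lambda>(i,j). A $$ (i div dim_row B, j div dim_col B) * B $$ (i mod dim_row B, j mod dim_col B))"

definition unit_vec :: "nat \<Rightarrow> complex vec \<Rightarrow> bool" where
  "unit_vec n v \<longleftrightarrow> v \<in> carrier_vec n \<and> braket v v = 1"

definition psd :: "nat \<Rightarrow> complex mat \<Rightarrow> bool" where
  "psd n A \<longleftrightarrow> A \<in> carrier_mat n n \<and>
     (\<forall>v \<in> carrier_vec n. braket v (A *\<^sub>v v) \<in> \<real> \<and> 0 \<le> Re (braket v (A *\<^sub>v v)))"

definition msum :: "nat \<Rightarrow> complex mat list \<Rightarrow> complex mat" where
  "msum n Ms = foldr (+) Ms (0\<^sub>m n n)"

definition povm :: "nat \<Rightarrow> (nat \<Rightarrow> complex mat) \<Rightarrow> bool" where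
  "povm n Q \<longleftrightarrow> (\<forall>i<n. psd 4 (Q i)) \<and> msum 4 (map Q [0..<n]) = 1\<^sub>m 4"

definition success :: "nat \<Rightarrow> (nat \<Rightarrow> real) \<Rightarrow> (nat \<Rightarrow> complex vec) \<Rightarrow> (nat \<Rightarrow> complex mat) \<Rightarrow> real" where
  "success n p \<psi> Q = (\<Sum>i<n. p i * Re (braket (\<psi> i) (Q i *\<^sub>v \<psi> i)))"

definition opt_success :: "nat \<Rightarrow> (nat \<Rightarrow> real) \<Rightarrow> (nat \<Rightarrow> complex vec) \<Rightarrow> real" where
  "opt_success n p \<psi> = Sup {success n p \<psi> Q | Q. povm n Q}"

(* Finite-round LOCC protocols. A leaf of the protocol tree is a pair (A,B):
   A is the product of the Kraus operators applied so far by Alice (input dim 2,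
   output dimension arbitrary: ancillas / dimension changes allowed), likewise B
   for Bob; the joint Kraus operator of the branch is A (x) B.
   A step picks a leaf (depending on the whole classical history) and lets one
   party perform a local instrument (finite list of Kraus operators with
   sum K^H K = identity). *)
inductive_set locc_tree :: "(complex mat \<times> complex mat) list set" where
  start: "[(1\<^sub>m 2, 1\<^sub>m 2)] \<in> locc_tree"
| stepA: "\<lbrakk> Ls \<in> locc_tree; m < length Ls; Ls ! m = (A, B); Ks \<noteq> [];
            \<forall>K \<in> set Ks. dim_col K = dim_row A;
            msum (dim_row A) (map (\<lambda>K. adj K * K) Ks) = 1\<^sub>m (dim_row A) \<rbrakk>
          \<Longrightarrow> take m Ls @ map (\<lambda>K. (K * A, B)) Ks @ drop (Suc m) Ls \<in> locc_tree"
| stepB: "\<lbrakk> Ls \<in> locc_tree; m < length Ls; Ls ! m = (A, B); Ks \<noteq> [];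
            \<forall>K \<in> set Ks. dim_col K = dim_row B;
            msum (dim_row B) (map (\<lambda>K. adj K * K) Ks) = 1\<^sub>m (dim_row B) \<rbrakk>
          \<Longrightarrow> take m Ls @ map (\<lambda>K. (A, K * B)) Ks @ drop (Suc m) Ls \<in> locc_tree"

(* POVM element of a leaf: (A (x) B)^H (A (x) B) = A^H A (x) B^H B *)
definition leaf_effect :: "complex mat \<times> complex mat \<Rightarrow> complex mat" where
  "leaf_effect L = kron (adj (fst L) * fst L) (adj (snd L) * snd L)"

(* An n-outcome LOCC measurement: run an LOCC protocol and output a label
   f l < n computed from the leaf (i.e. from the classical record). *)
definition locc_povm :: "nat \<Rightarrow> (nat \<Rightarrow> complex mat) \<Rightarrow> bool" where
  "locc_povm n Q \<longleftrightarrow> (\<exists>Ls \<in> locc_tree. \<exists>f :: nat \<Rightarrow> nat. (\<forall>l<length Ls. f l < n) \<and>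
     (\<forall>i<n. Q i = msum 4 (map (\<lambda>l. leaf_effect (Ls ! l)) (filter (\<lambda>l. f l = i) [0..<length Ls]))))"

definition coeff_mat :: "complex vec \<Rightarrow> complex mat" where
  "coeff_mat \<Phi> = mat 2 2 (\<lambda>(a,b). \<Phi> $ (2*a + b))"

(* squared Schmidt coefficients = eigenvalues of the reduced state M M^H *)
definition lambda_min :: "complex vec \<Rightarrow> real" where
  "lambda_min \<Phi> = Min {Re k | k. eigenvalue (coeff_mat \<Phi> * adj (coeff_mat \<Phi>)) k}"

definition lincomb :: "nat \<Rightarrow> (nat \<Rightarrow> complex) \<Rightarrow> (nat \<Rightarrow> complex vec) \<Rightarrow> complex vec" where
  "lincomb n c \<psi> = vec 4 (\<lambda>r. \<Sum>l<n. c l * \<psi> l $ r)"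

end

theory Submission
  imports Defs "HOL-Analysis.L2_Norm"
begin

text \<open>
  Refine an optimal LOCC measurement into rank-one effects \<open>|c\<rangle>\<langle>c|\<close> and put
  \<open>w\<^sub>i = Q\<^sub>i \<psi>\<^sub>i\<close>. Optimality makes \<open>h = \<Sum>p\<^sub>i |\<psi>\<^sub>i\<rangle>\<langle>w\<^sub>i|\<close> Hermitian with
  \<open>h \<ge> p\<^sub>j |\<psi>\<^sub>j\<rangle>\<langle>\<psi>\<^sub>j|\<close>, and with linear independence it follows that the \<open>w\<^sub>i\<close> are pairwise
  orthogonal, are orthogonal to \<open>\<Phi>\<close>, and are discriminated without error by the protocol.
  Following a protocol until a local operator first loses rank shows that two of the \<open>w\<^sub>i\<close> must
  be product vectors. The third one, \<open>w\<^sub>m\<close>, then has up to scaling the same Schmidt coefficients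
  as \<open>\<Phi>\<close>. If \<open>\<lambda>\<close> is the smaller squared one, the product vector \<open>\<psi>\<^sub>m\<close> therefore satisfies
  \<open>\<parallel>w\<^sub>m\<parallel>\<^sup>2 \<le> 1 - \<lambda>\<close>. On the other hand, testing \<open>h \<ge> p\<^sub>m |\<psi>\<^sub>m\<rangle>\<langle>\<psi>\<^sub>m|\<close> on \<open>\<psi>\<^sub>m - w\<^sub>m\<close> gives
  \<open>p\<^sub>m\<^sup>2 (1 - \<parallel>w\<^sub>m\<parallel>\<^sup>2) \<le> \<Sum>\<^bsub>i\<noteq>m\<^esub> p\<^sub>i\<^sup>2 |\<langle>\<psi>\<^sub>m|\<psi>\<^sub>i\<rangle>|\<^sup>2\<close>, and the hypothesis forces
  \<open>\<parallel>w\<^sub>m\<parallel>\<^sup>2 > 1 - \<lambda>\<close>.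
\<close>

section \<open>Optimality conditions for rank-one families\<close>

definition ip :: "(nat \<Rightarrow> complex) \<Rightarrow> (nat \<Rightarrow> complex) \<Rightarrow> complex" where
  "ip x y = (\<Sum>r<4. cnj (x r) * y r)"

lemma ip_cnj: "cnj (ip x y) = ip y x"
  by (simp add: ip_def mult.commute)

lemma ip_add_right: "ip x (\<lambda>r. y r + z r) = ip x y + ip x z"
  by (simp add: ip_def algebra_simps sum.distrib)

lemma ip_diff_right: "ip x (\<lambda>r. y r - z r) = ip x y - ip x z"
  by (simp add: ip_def algebra_simps sum_subtractf)

lemma ip_scale_right: "ip x (\<lambda>r. a * y r) = a * ip x y"
  by (simp add: ip_def sum_distrib_left mult.left_commute)

lemma ip_sum_right: "ip x (\<lambda>r. \<Sum>k\<in>I. g k r) = (\<Sum>k\<in>I. ip x (g k))"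
  unfolding ip_def sum_distrib_left by (rule sum.swap)

lemma ip_add_left: "ip (\<lambda>r. y r + z r) x = ip y x + ip z x"
  by (simp add: ip_def algebra_simps sum.distrib)

lemma ip_diff_left: "ip (\<lambda>r. y r - z r) x = ip y x - ip z x"
  by (simp add: ip_def algebra_simps sum_subtractf)

lemma ip_scale_left: "ip (\<lambda>r. a * y r) x = cnj a * ip y x"
  by (simp add: ip_def sum_distrib_left mult.assoc)

lemma ip_sum_left: "ip (\<lambda>r. \<Sum>k\<in>I. g k r) x = (\<Sum>k\<in>I. ip (g k) x)"
  unfolding ip_def cnj_sum sum_distrib_right by (rule sum.swap)

lemmas ip_linear = ip_add_right ip_diff_right ip_scale_right ip_add_left ip_diff_left ip_scale_left

lemma ip_self: "ip x x = of_real (\<Sum>r<4. (cmod (x r))\<^sup>2)"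
  by (simp add: ip_def mult.commute complex_norm_square[symmetric])

lemma ip_self_nonneg: "0 \<le> Re (ip x x)"
  unfolding ip_self by (simp add: sum_nonneg)

lemma ip_self_real: "ip x x = of_real (Re (ip x x))"
  unfolding ip_self by simp

lemma cmod_ip_commute: "cmod (ip x y) = cmod (ip y x)"
  by (metis complex_mod_cnj ip_cnj)

lemma cmod_sq: "complex_of_real ((cmod z)\<^sup>2) = cnj z * z"
  unfolding complex_norm_square by (rule mult.commute)

lemma cmod_sum_mult_le:
  fixes a b :: "'a \<Rightarrow> complex"
  shows "(cmod (\<Sum>i\<in>A. a i * b i))\<^sup>2 \<le> (\<Sum>i\<in>A. (cmod (a i))\<^sup>2) * (\<Sum>i\<in>A. (cmod (b i))\<^sup>2)"
proof -
  have "cmod (\<Sum>i\<in>A. a i * b i) \<le> (\<Sum>i\<in>A. \<bar>cmod (a i)\<bar> * \<bar>cmod (b i)\<bar>)"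
    by (rule order_trans[OF norm_sum]) (simp add: norm_mult)
  also have "\<dots> \<le> L2_set (\<lambda>i. cmod (a i)) A * L2_set (\<lambda>i. cmod (b i)) A"
    by (rule L2_set_mult_ineq)
  finally have "(cmod (\<Sum>i\<in>A. a i * b i))\<^sup>2 \<le> (L2_set (\<lambda>i. cmod (a i)) A * L2_set (\<lambda>i. cmod (b i)) A)\<^sup>2"
    by (rule power_mono) simp
  also have "\<dots> = (\<Sum>i\<in>A. (cmod (a i))\<^sup>2) * (\<Sum>i\<in>A. (cmod (b i))\<^sup>2)"
    by (simp add: L2_set_def power_mult_distrib sum_nonneg)
  finally show ?thesis .
qed

text \<open>Perturbation expansions are available only for small \<open>e > 0\<close>; dividing by
  \<open>e\<close> and letting it tend to 0 leaves the sign of the first-order coefficient.\<close>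

lemma first_order_nonpos:
  fixes a b e0 :: real
  assumes e0: "0 < e0" and le: "\<And>e. 0 < e \<Longrightarrow> e \<le> e0 \<Longrightarrow> 2 * e * a + e\<^sup>2 * b \<le> 0"
  shows "a \<le> 0"
proof (rule ccontr)
  assume "\<not> a \<le> 0"
  then have a: "a > 0" by simp
  \<comment> \<open>The second bound gives \<open>e * \<bar>b\<bar> \<le> a\<close>, so the
    quadratic term cannot cancel \<open>2 * e * a\<close>.\<close>
  define e where "e = min e0 (a / (\<bar>b\<bar> + 1))"
  have e: "0 < e" "e \<le> e0" using a e0 by (auto simp: e_def)
  have "e * \<bar>b\<bar> \<le> e * (\<bar>b\<bar> + 1)" using e by simp
  also have "\<dots> \<le> a / (\<bar>b\<bar> + 1) * (\<bar>b\<bar> + 1)"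
    by (rule mult_right_mono) (auto simp: e_def)
  also have "\<dots> = a" by simp
  finally have "e * \<bar>b\<bar> \<le> a" .
  moreover have "- (e * \<bar>b\<bar>) \<le> e * b"
    using e by (metis abs_ge_minus_self abs_mult abs_of_pos minus_le_iff)
  ultimately have "0 < 2 * a + e * b" using a by linarith
  then have "0 < e * (2 * a + e * b)" using e by simp
  also have "\<dots> = 2 * e * a + e\<^sup>2 * b" by (simp add: algebra_simps power2_eq_square)
  finally show False using le[OF e] by simp
qed

text \<open>Without a constant term the quadratic is 0 at \<open>t = 0\<close>, which is its
  minimum, so the linear part vanishes. This passes from a zero of a nonnegative Hermitian form to
  its kernel.\<close>

lemma semidefinite_kernel:
  fixes g :: complex and r :: real
  assumes nonneg: "\<And>t. 0 \<le> 2 * Re (t * g) + (cmod t)\<^sup>2 * r"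
  shows "g = 0"
proof -
  have "(cmod g)\<^sup>2 \<le> 0"
  proof (rule first_order_nonpos[of 1 _ "- ((cmod g)\<^sup>2 * r)"])
    fix e :: real
    assume "0 < e" "e \<le> 1"
    have "Re (- of_real e * cnj g * g) = - (e * (cmod g)\<^sup>2)"
      unfolding cmod_power2 by (simp add: power2_eq_square algebra_simps)
    then show "2 * e * (cmod g)\<^sup>2 + e\<^sup>2 * - ((cmod g)\<^sup>2 * r) \<le> 0"
      using nonneg[of "- of_real e * cnj g"] by (simp add: norm_mult power_mult_distrib)
  qed simp
  then show ?thesis by simp
qed

section \<open>Rank-one refinements and first-order optimality\<close>

text \<open>A family with \<open>resolution I c\<close> is a POVM refined into rank-one effects
  \<open>|c k\<rangle>\<langle>c k|\<close>; an element labelled \<open>f k\<close> is a guess for the state \<open>\<psi> (f k)\<close>.\<close>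

definition resolution :: "'a set \<Rightarrow> ('a \<Rightarrow> nat \<Rightarrow> complex) \<Rightarrow> bool" where
  "resolution I c \<longleftrightarrow> finite I \<and>
     (\<forall>r<4. \<forall>s<4. (\<Sum>k\<in>I. c k r * cnj (c k s)) = (if r = s then 1 else 0))"

definition guess_prob ::
  "(nat \<Rightarrow> real) \<Rightarrow> (nat \<Rightarrow> nat \<Rightarrow> complex) \<Rightarrow> 'a set \<Rightarrow> ('a \<Rightarrow> nat \<Rightarrow> complex) \<Rightarrow> ('a \<Rightarrow> nat) \<Rightarrow> real"
  where "guess_prob p \<psi> I c f = (\<Sum>k\<in>I. p (f k) * (cmod (ip (c k) (\<psi> (f k))))\<^sup>2)"

lemma resolution_ip:
  assumes "resolution I c"
  shows "(\<Sum>k\<in>I. ip x (c k) * ip (c k) y) = ip x y"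
proof -
  have "(\<Sum>k\<in>I. ip x (c k) * ip (c k) y)
      = (\<Sum>k\<in>I. \<Sum>r<4. \<Sum>s<4. cnj (x r) * y s * (c k r * cnj (c k s)))"
    unfolding ip_def sum_product by (simp add: algebra_simps)
  also have "\<dots> = (\<Sum>r<4. \<Sum>s<4. \<Sum>k\<in>I. cnj (x r) * y s * (c k r * cnj (c k s)))"
    by (subst sum.swap, rule sum.cong[OF refl], rule sum.swap)
  also have "\<dots> = (\<Sum>r<4. \<Sum>s<4. if r = s then cnj (x r) * y s else 0)"
    using assms by (intro sum.cong refl) (simp add: resolution_def sum_distrib_left[symmetric])
  also have "\<dots> = ip x y" by (simp add: ip_def)
  finally show ?thesis .
qed

text \<open>Optimality is required only against families with one extra member, because the
  variation below adds a single rank-one effect; the \<open>option\<close> type supplies its index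
  \<open>None\<close>. Vectors are functions on \<open>nat\<close> of which only the entries below 4
  count.\<close>

locale optimal_family =
  fixes n :: nat and p :: "nat \<Rightarrow> real" and \<psi> :: "nat \<Rightarrow> nat \<Rightarrow> complex"
    and I :: "'a set" and c :: "'a \<Rightarrow> nat \<Rightarrow> complex" and f :: "'a \<Rightarrow> nat"
  assumes resolution: "resolution I c"
    and label: "\<And>k. k \<in> I \<Longrightarrow> f k < n"
    and p_pos: "\<And>i. i < n \<Longrightarrow> 0 < p i"
    and indep: "\<And>a i. (\<And>r. r < 4 \<Longrightarrow> (\<Sum>i<n. a i * \<psi> i r) = 0) \<Longrightarrow> i < n \<Longrightarrow> a i = 0"
    and optimal: "\<And>(c' :: 'a option \<Rightarrow> nat \<Rightarrow> complex) f'.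
      resolution (insert None (Some ` I)) c' \<Longrightarrow> (\<And>k. k \<in> insert None (Some ` I) \<Longrightarrow> f' k < n) \<Longrightarrow>
      guess_prob p \<psi> (insert None (Some ` I)) c' f' \<le> guess_prob p \<psi> I c f"
begin

lemma fin: "finite I"
  using resolution by (simp add: resolution_def)

definition w :: "nat \<Rightarrow> nat \<Rightarrow> complex" where
  "w i r = (\<Sum>k\<in>{k\<in>I. f k = i}. ip (c k) (\<psi> i) * c k r)"

lemma ip_w_right: "ip x (w i) = (\<Sum>k\<in>{k\<in>I. f k = i}. ip x (c k) * ip (c k) (\<psi> i))"
  unfolding w_def[abs_def] ip_sum_right ip_scale_right by (simp add: mult.commute)

lemma ip_w_left: "ip (w i) x = (\<Sum>k\<in>{k\<in>I. f k = i}. ip (\<psi> i) (c k) * ip (c k) x)"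
  unfolding w_def[abs_def] by (simp add: ip_sum_left ip_scale_left ip_cnj)

lemma sum_by_label: "(\<Sum>i<n. \<Sum>k\<in>{k\<in>I. f k = i}. g i k) = (\<Sum>k\<in>I. g (f k) k)"
  for g :: "nat \<Rightarrow> 'a \<Rightarrow> 'b::comm_monoid_add"
proof -
  have "(\<Sum>i<n. \<Sum>k\<in>{k\<in>I. f k = i}. g i k) = (\<Sum>i<n. \<Sum>k\<in>{k\<in>I. f k = i}. g (f k) k)"
    by (intro sum.cong) auto
  also have "\<dots> = (\<Sum>k\<in>I. g (f k) k)"
    by (rule sum.group) (use fin label in auto)
  finally show ?thesis .
qed

lemma sum_insert_option: "sum g (insert None (Some ` I)) = g None + (\<Sum>k\<in>I. g (Some k))"
  for g :: "'a option \<Rightarrow> 'b::comm_monoid_add"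
  using fin by (subst sum.insert) (auto simp: sum.reindex)

text \<open>With \<open>P = |v><v|\<close>, the competitor replaces each \<open>c k\<close> by
  \<open>(1 - e P) c k\<close> and adds the effect \<open>q P\<close> with guess \<open>j\<close>.
  To first order its success changes by \<open>2 * e\<close> times the left side minus the right
  side, which optimality forbids to be positive.\<close>

lemma variation:
  assumes j: "j < n"
  shows "p j * (cmod (ip v (\<psi> j)))\<^sup>2 \<le> (\<Sum>i<n. p i * Re (ip (w i) v * ip v (\<psi> i)))"
proof -
  define N where "N = Re (ip v v)"
  have N: "0 \<le> N" "ip v v = of_real N"
    unfolding N_def by (rule ip_self_nonneg, rule ip_self_real)
  define X where "X = (\<Sum>i<n. p i * Re (ip (w i) v * ip v (\<psi> i)))"
  define Y where "Y = (\<Sum>k\<in>I. p (f k) * (cmod (ip (c k) v * ip v (\<psi> (f k))))\<^sup>2)"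
  have "p j * (cmod (ip v (\<psi> j)))\<^sup>2 - X \<le> 0"
  proof (rule first_order_nonpos[of "1 / (N + 1)" _ "Y - p j * N * (cmod (ip v (\<psi> j)))\<^sup>2"])
    show "0 < 1 / (N + 1)" using N by simp
  next
    fix e :: real
    assume e: "0 < e" "e \<le> 1 / (N + 1)"
    \<comment> \<open>Since \<open>P\<^sup>2 = N P\<close>, one has
      \<open>(1 - e P)\<^sup>2 = 1 - q P\<close>, so adding \<open>q P\<close> restores the
      identity. The bound on \<open>e\<close> keeps \<open>q\<close> nonnegative, as the square root
      below requires.\<close>
    define q where "q = 2 * e - e\<^sup>2 * N"
    have "e * N \<le> e * (N + 1)" using e by simp
    also have "\<dots> \<le> 1" using e N by (simp add: field_simps)
    finally have "e * (e * N) \<le> e * 1" using e by (intro mult_left_mono) auto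
    then have q: "0 \<le> q" using e by (simp add: q_def power2_eq_square)
    define c' where "c' k = (case k of None \<Rightarrow> (\<lambda>r. of_real (sqrt q) * v r)
        | Some k \<Rightarrow> (\<lambda>r. c k r - (of_real e * ip v (c k)) * v r))" for k
    define f' where "f' k = (case k of None \<Rightarrow> j | Some k \<Rightarrow> f k)" for k
    have delta: "(\<Sum>k\<in>I. c k r * cnj (c k s)) = (if r = s then 1 else 0)" if "r < 4" "s < 4" for r s
      using resolution that by (simp add: resolution_def)
    have c1: "(\<Sum>k\<in>I. ip v (c k) * cnj (c k s)) = cnj (v s)" if "s < 4" for s
    proof -
      have "(\<Sum>k\<in>I. ip v (c k) * cnj (c k s)) = (\<Sum>r<4. cnj (v r) * (\<Sum>k\<in>I. c k r * cnj (c k s)))"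
        unfolding ip_def sum_distrib_left sum_distrib_right by (subst sum.swap) (simp add: mult.assoc)
      also have "\<dots> = (\<Sum>r<4. if r = s then cnj (v r) else 0)"
        using that by (intro sum.cong) (auto simp: delta)
      finally show ?thesis using that by simp
    qed
    have c2: "(\<Sum>k\<in>I. ip (c k) v * c k r) = v r" if "r < 4" for r
      using arg_cong[OF c1[OF that], of cnj] by (simp add: ip_cnj)
    have c3: "(\<Sum>k\<in>I. ip v (c k) * ip (c k) v) = of_real N"
      using resolution_ip[OF resolution] N by simp
    have res: "resolution (insert None (Some ` I)) c'"
      unfolding resolution_def
    proof (intro conjI allI impI)
      fix r s :: nat
      assume rs: "r < 4" "s < 4"
      have "(\<Sum>k\<in>insert None (Some ` I). c' k r * cnj (c' k s))
        = of_real q * v r * cnj (v s) + (\<Sum>k\<in>I. (c k r - (of_real e * ip v (c k)) * v r) * cnj (c k s - (of_real e * ip v (c k)) * v s))"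
        using q by (simp add: sum_insert_option c'_def algebra_simps flip: of_real_mult real_sqrt_mult)
      also have "(\<Sum>k\<in>I. (c k r - (of_real e * ip v (c k)) * v r) * cnj (c k s - (of_real e * ip v (c k)) * v s))
        = (\<Sum>k\<in>I. c k r * cnj (c k s) - of_real e * v r * (ip v (c k) * cnj (c k s))
           - of_real e * cnj (v s) * (ip (c k) v * c k r) + (of_real e)\<^sup>2 * v r * cnj (v s) * (ip v (c k) * ip (c k) v))"
        by (intro sum.cong) (simp_all add: algebra_simps ip_cnj power2_eq_square)
      also have "\<dots> = (if r = s then 1 else 0) - of_real e * v r * cnj (v s) - of_real e * cnj (v s) * v r
          + (of_real e)\<^sup>2 * v r * cnj (v s) * of_real N"
        unfolding sum.distrib sum_subtractf sum_distrib_left[symmetric] delta[OF rs] c1[OF rs(2)] c2[OF rs(1)] c3 by simp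
      finally show "(\<Sum>k\<in>insert None (Some ` I). c' k r * cnj (c' k s)) = (if r = s then 1 else 0)"
        by (simp add: q_def algebra_simps)
    qed (use fin in simp)
    have term_eq: "(cmod (ip (c' (Some k)) (\<psi> i)))\<^sup>2 = (cmod (ip (c k) (\<psi> i)))\<^sup>2
        - 2 * e * Re (ip (\<psi> i) (c k) * ip (c k) v * ip v (\<psi> i)) + e\<^sup>2 * (cmod (ip (c k) v * ip v (\<psi> i)))\<^sup>2" for k i
    proof -
      have *: "(cmod (a - of_real e * b))\<^sup>2 = (cmod a)\<^sup>2 - 2 * e * Re (cnj a * b) + e\<^sup>2 * (cmod b)\<^sup>2" for a b
        unfolding cmod_power2 by (simp add: power2_eq_square algebra_simps)
      have "ip (c' (Some k)) (\<psi> i) = ip (c k) (\<psi> i) - of_real e * (ip (c k) v * ip v (\<psi> i))"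
        by (simp add: c'_def ip_linear ip_cnj)
      then show ?thesis
        using *[of "ip (c k) (\<psi> i)" "ip (c k) v * ip v (\<psi> i)"] by (simp only: ip_cnj mult.assoc)
    qed
    have X_eq: "X = (\<Sum>k\<in>I. p (f k) * Re (ip (\<psi> (f k)) (c k) * ip (c k) v * ip v (\<psi> (f k))))"
      unfolding X_def ip_w_left
      using sum_by_label[of "\<lambda>i k. p i * Re (ip (\<psi> i) (c k) * ip (c k) v * ip v (\<psi> i))"]
      by (simp only: sum_distrib_left sum_distrib_right Re_sum)
    have labels: "f' k < n" if "k \<in> insert None (Some ` I)" for k
      using that label j by (auto simp: f'_def)
    have "guess_prob p \<psi> (insert None (Some ` I)) c' f'
      = p j * (q * (cmod (ip v (\<psi> j)))\<^sup>2) + (\<Sum>k\<in>I. p (f k) * (cmod (ip (c' (Some k)) (\<psi> (f k))))\<^sup>2)"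
      using q by (simp add: guess_prob_def sum_insert_option f'_def c'_def ip_linear norm_mult power_mult_distrib)
    also have "(\<Sum>k\<in>I. p (f k) * (cmod (ip (c' (Some k)) (\<psi> (f k))))\<^sup>2)
      = (\<Sum>k\<in>I. p (f k) * (cmod (ip (c k) (\<psi> (f k))))\<^sup>2
         - 2 * e * (p (f k) * Re (ip (\<psi> (f k)) (c k) * ip (c k) v * ip v (\<psi> (f k))))
         + e\<^sup>2 * (p (f k) * (cmod (ip (c k) v * ip v (\<psi> (f k))))\<^sup>2))"
      unfolding term_eq by (intro sum.cong) (simp_all add: algebra_simps)
    also have "\<dots> = guess_prob p \<psi> I c f - 2 * e * X + e\<^sup>2 * Y"
      unfolding sum.distrib sum_subtractf sum_distrib_left[symmetric] X_eq Y_def guess_prob_def by simp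
    finally have "p j * (q * (cmod (ip v (\<psi> j)))\<^sup>2) - 2 * e * X + e\<^sup>2 * Y \<le> 0"
      using optimal[OF res, of f', OF labels] by linarith
    then show "2 * e * (p j * (cmod (ip v (\<psi> j)))\<^sup>2 - X) + e\<^sup>2 * (Y - p j * N * (cmod (ip v (\<psi> j)))\<^sup>2) \<le> 0"
      by (simp add: q_def algebra_simps)
  qed
  then show ?thesis by (simp add: X_def)
qed

section \<open>Dual certificate and complementary slackness\<close>

text \<open>The Hermitian part of \<open>\<Sum>i. p i |\<psi> i\<rangle>\<langle>w i|\<close>; it is the dual certificate of optimality.\<close>

definition h :: "(nat \<Rightarrow> complex) \<Rightarrow> (nat \<Rightarrow> complex) \<Rightarrow> complex" where
  "h x y = (\<Sum>i<n. of_real (p i / 2) * (ip x (\<psi> i) * ip (w i) y + ip x (w i) * ip (\<psi> i) y))"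

lemma h_cnj: "cnj (h x y) = h y x"
  by (simp add: h_def ip_cnj algebra_simps)

text \<open>Dual feasibility: on the diagonal the Hermitian part equals the real part of the
  operator it comes from, so \<open>variation\<close> applies.\<close>

lemma h_ge: "j < n \<Longrightarrow> p j * (cmod (ip v (\<psi> j)))\<^sup>2 \<le> Re (h v v)"
proof -
  have "Re (h v v) = (\<Sum>i<n. p i * Re (ip (w i) v * ip v (\<psi> i)))"
  proof -
    have "Re (of_real (p i / 2) * (ip v (\<psi> i) * ip (w i) v + ip v (w i) * ip (\<psi> i) v)) = p i * Re (ip (w i) v * ip v (\<psi> i))" for i
    proof -
      have "ip v (w i) * ip (\<psi> i) v = cnj (ip (w i) v * ip v (\<psi> i))"
        by (simp add: ip_cnj)
      then show ?thesis by (simp add: mult.commute)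
    qed
    then show ?thesis unfolding h_def by (simp only: Re_sum)
  qed
  then show "j < n \<Longrightarrow> ?thesis" using variation[of j v] by simp
qed

lemma h_resolution_right: "(\<Sum>k\<in>I. h x (c k) * ip (c k) y) = h x y"
proof -
  have "(\<Sum>k\<in>I. h x (c k) * ip (c k) y)
    = (\<Sum>i<n. \<Sum>k\<in>I. of_real (p i / 2) * ip x (\<psi> i) * (ip (w i) (c k) * ip (c k) y)
        + of_real (p i / 2) * ip x (w i) * (ip (\<psi> i) (c k) * ip (c k) y))"
    unfolding h_def sum_distrib_right by (subst sum.swap) (simp add: algebra_simps)
  also have "\<dots> = h x y"
    unfolding h_def sum.distrib sum_distrib_left[symmetric] resolution_ip[OF resolution]
    by (simp add: algebra_simps sum.distrib)
  finally show ?thesis .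
qed

lemma ip_psi_w: "ip (\<psi> i) (w i) = of_real (\<Sum>k\<in>{k\<in>I. f k = i}. (cmod (ip (c k) (\<psi> i)))\<^sup>2)"
  unfolding ip_w_right of_real_sum
  by (intro sum.cong refl) (simp only: cmod_sq ip_cnj)

text \<open>Summing over a resolution takes the trace, so the certificate has the value of the
  measurement: there is no duality gap.\<close>

lemma h_trace: "(\<Sum>k\<in>I. h (c k) (c k)) = of_real (guess_prob p \<psi> I c f)"
proof -
  have "(\<Sum>k\<in>I. h (c k) (c k))
    = (\<Sum>i<n. \<Sum>k\<in>I. of_real (p i / 2) * (ip (w i) (c k) * ip (c k) (\<psi> i))
        + of_real (p i / 2) * (ip (\<psi> i) (c k) * ip (c k) (w i)))"
    unfolding h_def by (subst sum.swap) (simp add: algebra_simps)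
  also have "\<dots> = (\<Sum>i<n. of_real (p i / 2) * (ip (w i) (\<psi> i) + ip (\<psi> i) (w i)))"
    unfolding h_def sum.distrib sum_distrib_left[symmetric] resolution_ip[OF resolution]
    by (simp add: algebra_simps sum.distrib)
  also have "\<dots> = (\<Sum>i<n. of_real (p i) * ip (\<psi> i) (w i))"
  proof (intro sum.cong refl)
    fix i
    have "ip (w i) (\<psi> i) = ip (\<psi> i) (w i)"
      by (metis ip_cnj ip_psi_w complex_cnj_complex_of_real)
    then show "of_real (p i / 2) * (ip (w i) (\<psi> i) + ip (\<psi> i) (w i)) = of_real (p i) * ip (\<psi> i) (w i)"
      by (simp add: algebra_simps)
  qed
  also have "\<dots> = of_real (\<Sum>i<n. \<Sum>k\<in>{k\<in>I. f k = i}. p i * (cmod (ip (c k) (\<psi> i)))\<^sup>2)"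
    unfolding ip_psi_w by (simp add: sum_distrib_left)
  also have "\<dots> = of_real (guess_prob p \<psi> I c f)"
    unfolding sum_by_label guess_prob_def ..
  finally show ?thesis .
qed

text \<open>The slacks are nonnegative by \<open>h_ge\<close> and sum to zero by
  \<open>h_trace\<close>, so each of them vanishes.\<close>

lemma slack_zero:
  assumes k: "k \<in> I"
  shows "Re (h (c k) (c k)) = p (f k) * (cmod (ip (c k) (\<psi> (f k))))\<^sup>2"
proof -
  have "(\<Sum>k\<in>I. Re (h (c k) (c k)) - p (f k) * (cmod (ip (c k) (\<psi> (f k))))\<^sup>2) = 0"
    using arg_cong[OF h_trace, of Re] by (simp add: sum_subtractf guess_prob_def)
  then have "\<forall>k\<in>I. Re (h (c k) (c k)) - p (f k) * (cmod (ip (c k) (\<psi> (f k))))\<^sup>2 = 0"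
    by (subst (asm) sum_nonneg_eq_0_iff) (use fin label h_ge in auto)
  then show ?thesis using k by simp
qed

lemma h_add_scale: "h (\<lambda>r. x r + t * y r) (\<lambda>r. x r + t * y r)
    = h x x + t * h x y + cnj t * h y x + cnj t * t * h y y"
  unfolding h_def ip_linear
  by (simp only: sum_distrib_left sum.distrib[symmetric]) (simp add: algebra_simps)

text \<open>Complementary slackness: \<open>h\<close> minus the weighted projector of the guessed
  state is a nonnegative form that vanishes at \<open>c k\<close>, so \<open>c k\<close> lies in its
  kernel. Expanding the form at \<open>c k + t x\<close> feeds
  \<open>semidefinite_kernel\<close>.\<close>

lemma h_kernel:
  assumes k: "k \<in> I"
  shows "h x (c k) = of_real (p (f k)) * (ip x (\<psi> (f k)) * ip (\<psi> (f k)) (c k))"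
proof -
  let ?\<psi> = "\<psi> (f k)" and ?p = "p (f k)"
  define g where "g = h (c k) x - of_real ?p * (ip (c k) ?\<psi> * ip ?\<psi> x)"
  have "g = 0"
  proof (rule semidefinite_kernel[of _ "Re (h x x) - ?p * (cmod (ip x ?\<psi>))\<^sup>2"])
    fix t :: complex
    have "Re (h (\<lambda>r. c k r + t * x r) (\<lambda>r. c k r + t * x r))
      = Re (h (c k) (c k)) + 2 * Re (t * h (c k) x) + (cmod t)\<^sup>2 * Re (h x x)"
    proof -
      have "cnj t * h x (c k) = cnj (t * h (c k) x)" by (simp add: h_cnj)
      then have "Re (cnj t * h x (c k)) = Re (t * h (c k) x)" by (simp only: cnj.sel)
      then show ?thesis
        unfolding h_add_scale cmod_sq[symmetric] plus_complex.sel by (simp flip: of_real_power)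
    qed
    moreover have "(cmod (ip (\<lambda>r. c k r + t * x r) ?\<psi>))\<^sup>2
      = (cmod (ip (c k) ?\<psi>))\<^sup>2 + 2 * Re (t * (ip (c k) ?\<psi> * ip ?\<psi> x)) + (cmod t)\<^sup>2 * (cmod (ip x ?\<psi>))\<^sup>2"
    proof -
      have *: "(cmod (a + cnj t * cnj b))\<^sup>2 = (cmod a)\<^sup>2 + 2 * Re (t * (a * b)) + (cmod t)\<^sup>2 * (cmod b)\<^sup>2" for a b
        unfolding cmod_power2 by (simp add: power2_eq_square algebra_simps)
      show ?thesis using *[of "ip (c k) ?\<psi>" "ip ?\<psi> x"] by (simp add: ip_linear ip_cnj cmod_ip_commute[of x])
    qed
    moreover note h_ge[OF label[OF k], of "\<lambda>r. c k r + t * x r"] slack_zero[OF k]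
    moreover have "Re (t * g) = Re (t * h (c k) x) - ?p * Re (t * (ip (c k) ?\<psi> * ip ?\<psi> x))"
    proof -
      have "t * g = t * h (c k) x - of_real ?p * (t * (ip (c k) ?\<psi> * ip ?\<psi> x))"
        by (simp add: g_def algebra_simps)
      then show ?thesis by (simp only: minus_complex.sel Re_complex_of_real Im_complex_of_real times_complex.sel(1)[of "of_real _"])
    qed
    ultimately show "0 \<le> 2 * Re (t * g) + (cmod t)\<^sup>2 * (Re (h x x) - ?p * (cmod (ip x ?\<psi>))\<^sup>2)"
      by (simp only: algebra_simps)
  qed
  then have "cnj (h (c k) x) = cnj (of_real ?p * (ip (c k) ?\<psi> * ip ?\<psi> x))"
    by (simp add: g_def)
  then show ?thesis by (simp add: h_cnj ip_cnj algebra_simps)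
qed

text \<open>Inserting the resolution and applying \<open>h_kernel\<close> termwise shows that the
  operator \<open>\<Sum>i. p i |\<psi> i><w i|\<close> is itself Hermitian and coincides with
  \<open>h\<close>.\<close>

lemma h_eq: "h x y = (\<Sum>i<n. of_real (p i) * (ip x (\<psi> i) * ip (w i) y))"
proof -
  have "h x y = (\<Sum>k\<in>I. of_real (p (f k)) * (ip x (\<psi> (f k)) * (ip (\<psi> (f k)) (c k) * ip (c k) y)))"
    unfolding h_resolution_right[symmetric, of x y]
    by (intro sum.cong refl) (simp add: h_kernel algebra_simps)
  also have "\<dots> = (\<Sum>i<n. of_real (p i) * (ip x (\<psi> i) * ip (w i) y))"
    unfolding ip_w_left sum_distrib_left by (rule sum_by_label[symmetric])
  finally show ?thesis .
qed

lemma h_eq': "h x y = (\<Sum>i<n. of_real (p i) * (ip x (w i) * ip (\<psi> i) y))"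
  using arg_cong[OF h_eq[of y x], of cnj] by (simp add: h_cnj ip_cnj mult.commute)

lemma indep_ip:
  assumes zero: "\<And>x. (\<Sum>i<n. a i * ip x (\<psi> i)) = 0" and i: "i < n"
  shows "a i = 0"
proof (rule indep[OF _ i])
  fix r :: nat
  assume r: "r < 4"
  have "ip (\<lambda>s. if s = r then 1 else 0) y = y r" for y
  proof -
    have "ip (\<lambda>s. if s = r then 1 else 0) y = (\<Sum>s<4. if s = r then y s else 0)"
      unfolding ip_def by (intro sum.cong) auto
    then show ?thesis using r by simp
  qed
  then show "(\<Sum>i<n. a i * \<psi> i r) = 0"
    using zero[of "\<lambda>s. if s = r then 1 else 0"] by simp
qed

text \<open>\<open>h_eq\<close> and \<open>h_kernel\<close> expand \<open>h x (c k)\<close> in the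
  same numbers \<open>ip x (\<psi> i)\<close>, so independence equates the coefficients. The
  measurement thus discriminates the \<open>w j\<close> without error.\<close>

lemma ip_w_c:
  assumes k: "k \<in> I" and j: "j < n"
  shows "ip (w j) (c k) = (if j = f k then ip (\<psi> j) (c k) else 0)"
proof -
  define a where "a i = of_real (p i) * (ip (w i) (c k) - (if i = f k then ip (\<psi> i) (c k) else 0))" for i
  have "a j = 0"
  proof (rule indep_ip[OF _ j])
    fix x
    have "(\<Sum>i<n. a i * ip x (\<psi> i)) = h x (c k) - (\<Sum>i<n. if i = f k then of_real (p i) * (ip x (\<psi> i) * ip (\<psi> i) (c k)) else 0)"
      unfolding h_eq sum_subtractf[symmetric] by (intro sum.cong) (simp_all add: a_def algebra_simps)
    also have "\<dots> = 0" using h_kernel[OF k] label[OF k] by simp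
    finally show "(\<Sum>i<n. a i * ip x (\<psi> i)) = 0" .
  qed
  then show ?thesis using p_pos[OF j] by (simp add: a_def)
qed

text \<open>\<open>w i\<close> is a combination of the \<open>c k\<close> with label
  \<open>i\<close>, and every other \<open>w j\<close> is orthogonal to those.\<close>

lemma ip_w_w:
  assumes "i < n" "j < n"
  shows "ip (w j) (w i) = (if i = j then ip (\<psi> i) (w i) else 0)"
proof -
  have "ip (w j) (w i) = (\<Sum>k\<in>{k\<in>I. f k = i}. if i = j then ip (\<psi> i) (c k) * ip (c k) (\<psi> i) else 0)"
    unfolding ip_w_right using assms by (intro sum.cong) (auto simp: ip_w_c)
  then show ?thesis by (simp add: ip_w_right)
qed

text \<open>By \<open>h_eq'\<close> such a \<open>y\<close> is annihilated by \<open>h\<close>;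
  reading this through \<open>h_eq\<close> and independence kills each \<open>ip (w j) y\<close>. It
  will be applied to \<open>\<Phi>\<close>.\<close>

lemma ip_w_perp:
  assumes "\<And>i. i < n \<Longrightarrow> ip (\<psi> i) y = 0" and j: "j < n"
  shows "ip (w j) y = 0"
proof -
  have "of_real (p j) * ip (w j) y = 0"
  proof (rule indep_ip[OF _ j])
    fix x
    have "(\<Sum>i<n. of_real (p i) * ip (w i) y * ip x (\<psi> i)) = h x y"
      unfolding h_eq by (simp add: algebra_simps)
    also have "\<dots> = 0" unfolding h_eq' using assms(1) by simp
    finally show "(\<Sum>i<n. of_real (p i) * ip (w i) y * ip x (\<psi> i)) = 0" .
  qed
  then show ?thesis using p_pos[OF j] by simp
qed

text \<open>With \<open>Q i\<close> the effect of label \<open>i\<close>, Cauchy-Schwarz for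
  \<open>Q i\<close> bounds each term by \<open><\<psi> i|Q i|\<psi> i> <v|Q i|v>\<close>. The first
  factor is at most 1, and the second factors add up to the squared norm of
  \<open>v\<close>.\<close>

lemma bessel_w:
  assumes unit: "\<And>i. i < n \<Longrightarrow> ip (\<psi> i) (\<psi> i) = 1"
  shows "(\<Sum>i<n. (cmod (ip (w i) v))\<^sup>2) \<le> Re (ip v v)"
proof -
  have "(cmod (ip (w i) v))\<^sup>2 \<le> (\<Sum>k\<in>{k\<in>I. f k = i}. (cmod (ip (c k) v))\<^sup>2)" if i: "i < n" for i
  proof -
    have "complex_of_real (\<Sum>k\<in>I. (cmod (ip (c k) (\<psi> i)))\<^sup>2) = 1"
      unfolding of_real_sum cmod_sq ip_cnj resolution_ip[OF resolution] unit[OF i] ..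
    then have one: "(\<Sum>k\<in>I. (cmod (ip (c k) (\<psi> i)))\<^sup>2) = 1" using of_real_eq_1_iff by blast
    have "(cmod (ip (w i) v))\<^sup>2 \<le> (\<Sum>k\<in>{k\<in>I. f k = i}. (cmod (ip (c k) (\<psi> i)))\<^sup>2) * (\<Sum>k\<in>{k\<in>I. f k = i}. (cmod (ip (c k) v))\<^sup>2)"
      unfolding ip_w_left cmod_ip_commute[of "c _" "\<psi> i"] by (rule cmod_sum_mult_le)
    also have "\<dots> \<le> 1 * (\<Sum>k\<in>{k\<in>I. f k = i}. (cmod (ip (c k) v))\<^sup>2)"
    proof (rule mult_right_mono)
      show "(\<Sum>k\<in>{k\<in>I. f k = i}. (cmod (ip (c k) (\<psi> i)))\<^sup>2) \<le> 1"
        unfolding one[symmetric] by (rule sum_mono2) (use fin in auto)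
    qed (simp add: sum_nonneg)
    finally show ?thesis by simp
  qed
  then have "(\<Sum>i<n. (cmod (ip (w i) v))\<^sup>2) \<le> (\<Sum>i<n. \<Sum>k\<in>{k\<in>I. f k = i}. (cmod (ip (c k) v))\<^sup>2)"
    by (intro sum_mono) simp
  also have "\<dots> = (\<Sum>k\<in>I. (cmod (ip (c k) v))\<^sup>2)" by (rule sum_by_label)
  also have "\<dots> = Re (ip v v)"
  proof -
    have "complex_of_real (\<Sum>k\<in>I. (cmod (ip (c k) v))\<^sup>2) = ip v v"
      unfolding of_real_sum cmod_sq ip_cnj resolution_ip[OF resolution] ..
    then show ?thesis by (metis Re_complex_of_real)
  qed
  finally show ?thesis .
qed

text \<open>Take \<open>h_ge\<close> at \<open>v = \<psi> m - w m\<close>, which is orthogonal to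
  \<open>w m\<close> and has squared norm \<open>V\<close>. It reduces to
  \<open>p m * V \<le> Re (h v (\<psi> m))\<close>, whose right side is controlled by Cauchy-Schwarz
  and \<open>bessel_w\<close>.\<close>

lemma residual_bound:
  assumes unit: "\<And>i. i < n \<Longrightarrow> ip (\<psi> i) (\<psi> i) = 1" and m: "m < n"
  shows "(p m)\<^sup>2 * (1 - Re (ip (w m) (w m))) \<le> (\<Sum>i\<in>{..<n} - {m}. (p i)\<^sup>2 * (cmod (ip (\<psi> m) (\<psi> i)))\<^sup>2)"
proof -
  define v where "v r = \<psi> m r - w m r" for r
  define S where "S = (\<Sum>i\<in>{..<n} - {m}. (p i)\<^sup>2 * (cmod (ip (\<psi> m) (\<psi> i)))\<^sup>2)"
  define V where "V = Re (ip v v)"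
  have pw: "ip (\<psi> m) (w m) = ip (w m) (w m)" using ip_w_w[OF m m] by simp
  have wp: "ip (w m) (\<psi> m) = ip (w m) (w m)" by (metis pw ip_cnj)
  have wv: "ip (w m) v = 0" by (simp add: v_def[abs_def] ip_linear wp)
  have vw: "ip v (w m) = 0" by (metis wv ip_cnj complex_cnj_zero)
  have vv: "ip v (\<psi> m) = ip v v"
    using vw by (simp add: v_def[abs_def] ip_linear)
  have "ip v v = 1 - ip (w m) (w m)"
    by (simp add: v_def[abs_def] ip_linear wp pw unit[OF m])
  then have V: "V = 1 - Re (ip (w m) (w m))" by (simp add: V_def)
  have V0: "0 \<le> V" unfolding V_def by (rule ip_self_nonneg)
  have hw: "h v (w m) = of_real (p m) * (ip v v * ip (w m) (w m))"
  proof -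
    have "h v (w m) = (\<Sum>i<n. if i = m then of_real (p m) * (ip v v * ip (w m) (w m)) else 0)"
      unfolding h_eq by (intro sum.cong) (auto simp: ip_w_w[OF m] vv pw[symmetric])
    then show ?thesis using m by simp
  qed
  have hv: "h v v = h v (\<psi> m) - h v (w m)"
    unfolding h_eq sum_subtractf[symmetric]
    by (intro sum.cong refl) (simp add: v_def[abs_def] ip_linear algebra_simps)
  have "p m * (cmod (ip v v))\<^sup>2 \<le> Re (h v v)" using h_ge[OF m, of v] by (simp add: vv)
  moreover have "ip v v = of_real V"
    unfolding V_def by (rule ip_self_real)
  moreover have "ip (w m) (w m) = of_real (1 - V)"
    unfolding V by (simp flip: ip_self_real)
  ultimately have "p m * V\<^sup>2 \<le> Re (h v (\<psi> m)) - p m * (V * (1 - V))"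
    unfolding hv hw using V0 by (simp add: power_abs flip: of_real_mult of_real_diff of_real_power)
  then have "p m * V \<le> Re (h v (\<psi> m))"
    by (simp add: power2_eq_square algebra_simps)
  also have "\<dots> \<le> cmod (h v (\<psi> m))" by (rule complex_Re_le_cmod)
  finally have le: "p m * V \<le> cmod (h v (\<psi> m))" .
  have "(p m)\<^sup>2 * V\<^sup>2 \<le> (cmod (h v (\<psi> m)))\<^sup>2"
    using power_mono[OF le, of 2] p_pos[OF m] V0 by (simp add: power_mult_distrib)
  \<comment> \<open>The term \<open>i = m\<close> drops out because \<open>v\<close> is orthogonal
    to \<open>w m\<close>; only overlaps with the other states remain.\<close>
  also have "h v (\<psi> m) = (\<Sum>i\<in>{..<n} - {m}. ip v (w i) * (of_real (p i) * ip (\<psi> i) (\<psi> m)))"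
    unfolding h_eq' using m by (subst sum.remove[of _ m]) (auto simp: vw algebra_simps)
  also have "(cmod \<dots>)\<^sup>2 \<le> (\<Sum>i\<in>{..<n} - {m}. (cmod (ip v (w i)))\<^sup>2) * (\<Sum>i\<in>{..<n} - {m}. (cmod (of_real (p i) * ip (\<psi> i) (\<psi> m)))\<^sup>2)"
    by (rule cmod_sum_mult_le)
  also have "(\<Sum>i\<in>{..<n} - {m}. (cmod (of_real (p i) * ip (\<psi> i) (\<psi> m)))\<^sup>2) = S"
    unfolding S_def by (intro sum.cong refl) (simp add: norm_mult power_mult_distrib cmod_ip_commute[of _ "\<psi> m"])
  also have "(\<Sum>i\<in>{..<n} - {m}. (cmod (ip v (w i)))\<^sup>2) * S \<le> V * S"
  proof (rule mult_right_mono)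
    have "(\<Sum>i\<in>{..<n} - {m}. (cmod (ip v (w i)))\<^sup>2) \<le> (\<Sum>i<n. (cmod (ip (w i) v))\<^sup>2)"
      unfolding cmod_ip_commute[of v] by (rule sum_mono2) auto
    also have "\<dots> \<le> V" unfolding V_def by (rule bessel_w[OF unit])
    finally show "(\<Sum>i\<in>{..<n} - {m}. (cmod (ip v (w i)))\<^sup>2) \<le> V" .
  qed (simp add: S_def sum_nonneg)
  finally have "V * ((p m)\<^sup>2 * V) \<le> V * S" by (simp add: power2_eq_square algebra_simps)
  \<comment> \<open>For \<open>V = 0\<close> the bound is trivial; otherwise one factor
    \<open>V\<close> cancels.\<close>
  then have "(p m)\<^sup>2 * V \<le> S"
    using V0 by (cases "V = 0") (auto simp: S_def sum_nonneg)
  then show ?thesis by (simp add: V S_def)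
qed

end

section \<open>Product vectors and Schmidt coefficients\<close>

text \<open>The determinant of the coefficient matrix in the index order \<open>2 * a + b\<close>.
  It vanishes exactly on product vectors, and for a unit vector its modulus is the product of the
  two Schmidt coefficients.\<close>

definition det4 :: "(nat \<Rightarrow> complex) \<Rightarrow> complex" where
  "det4 x = x 0 * x 3 - x 1 * x 2"

lemma ip_expand: "ip x y = cnj (x 0) * y 0 + cnj (x 1) * y 1 + cnj (x 2) * y 2 + cnj (x 3) * y 3"
  by (simp add: ip_def eval_nat_numeral)

text \<open>Keeps the index \<open>1\<close> from being rewritten to \<open>Suc 0\<close>, so that
  facts about \<open>x 1\<close> and \<open>v $ 1\<close> still match.\<close>

declare One_nat_def [simp del]

text \<open>A singular coefficient matrix has rank at most one; a nonzero entry of its first row, if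
  there is one, fixes the factors.\<close>

lemma det4_zero_tensor:
  assumes "det4 x = 0"
  shows "\<exists>u0 u1 v0 v1. x 0 = u0 * v0 \<and> x 1 = u0 * v1 \<and> x 2 = u1 * v0 \<and> x 3 = u1 * v1"
proof -
  have d: "x 0 * x 3 = x 1 * x 2" using assms by (simp add: det4_def)
  consider "x 0 \<noteq> 0" | "x 0 = 0" "x 1 \<noteq> 0" | "x 0 = 0" "x 1 = 0" by blast
  then show ?thesis
  proof cases
    case 1
    have "x 3 = x 2 / x 0 * x 1" using 1 d by (simp add: field_simps)
    then show ?thesis using 1
      by (intro exI[of _ 1] exI[of _ "x 2 / x 0"] exI[of _ "x 0"] exI[of _ "x 1"]) simp
  next
    case 2
    then have "x 2 = 0" using d by simp
    then show ?thesis using 2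
      by (intro exI[of _ 1] exI[of _ "x 3 / x 1"] exI[of _ "x 0"] exI[of _ "x 1"]) simp
  next
    case 3
    then show ?thesis
      by (intro exI[of _ 0] exI[of _ 1] exI[of _ "x 2"] exI[of _ "x 3"]) simp
  qed
qed

text \<open>In C^2 the orthogonal complement of a nonzero vector is the line through
  \<open>(- cnj v1, cnj v0)\<close>.\<close>

lemma perp_parallel:
  fixes a b v0 v1 :: complex
  assumes "v0 \<noteq> 0 \<or> v1 \<noteq> 0" "cnj v0 * a + cnj v1 * b = 0"
  shows "\<exists>s. a = - (s * cnj v1) \<and> b = s * cnj v0"
proof (cases "v0 = 0")
  case True
  then show ?thesis using assms by (intro exI[of _ "- (a / cnj v1)"]) auto
next
  case False
  then have "a = - (cnj v1 * b / cnj v0)"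
    using assms(2) by (simp add: field_simps eq_neg_iff_add_eq_0)
  then show ?thesis using False by (intro exI[of _ "b / cnj v0"]) auto
qed

text \<open>Up to scale, a vector orthogonal to both tensors is \<open>s\<close> times u tensor
  v-perp plus \<open>r\<close> times u-perp tensor v'-perp. Its determinant is proportional to
  \<open>s * r\<close> and its squared norm to \<open>|s|\<^sup>2 V + |r|\<^sup>2 V'\<close>;
  orthogonality of \<open>x\<close> and \<open>y\<close> ties their coefficients together so that
  the two ratios agree.\<close>

lemma det4_perp_tensors:
  assumes j: "wj 0 = u0 * v0" "wj 1 = u0 * v1" "wj 2 = u1 * v0" "wj 3 = u1 * v1"
    and k: "wk 0 = u0' * v0'" "wk 1 = u0' * v1'" "wk 2 = u1' * v0'" "wk 3 = u1' * v1'"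
    and u: "u0 \<noteq> 0 \<or> u1 \<noteq> 0" and v: "v0 \<noteq> 0 \<or> v1 \<noteq> 0"
    and u': "u0' \<noteq> 0 \<or> u1' \<noteq> 0" and v': "v0' \<noteq> 0 \<or> v1' \<noteq> 0"
    and uu: "cnj u0 * u0' + cnj u1 * u1' = 0"
    and x: "ip wj x = 0" "ip wk x = 0" and y: "ip wj y = 0" "ip wk y = 0" and xy: "ip x y = 0"
  shows "cmod (det4 x) * Re (ip y y) = cmod (det4 y) * Re (ip x x)"
proof -
  obtain t where t: "u0' = - (t * cnj u1)" "u1' = t * cnj u0"
    using perp_parallel[OF u uu] by blast
  then have t0: "t \<noteq> 0" using u' by auto
  define U where "U = cnj u0 * u0 + cnj u1 * u1"
  define V where "V = (cmod v0)\<^sup>2 + (cmod v1)\<^sup>2"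
  define V' where "V' = (cmod v0')\<^sup>2 + (cmod v1')\<^sup>2"
  \<comment> \<open>Up to sign, the determinant with rows v-perp and v'-perp.\<close>
  define K where "K = cnj v1 * cnj v0' - cnj v0 * cnj v1'"
  have UR: "U = of_real ((cmod u0)\<^sup>2 + (cmod u1)\<^sup>2)" unfolding U_def of_real_add cmod_sq ..
  have U0: "(cmod u0)\<^sup>2 + (cmod u1)\<^sup>2 \<noteq> 0"
    using u by (simp add: sum_power2_eq_zero_iff)
  have CV: "complex_of_real V = cnj v0 * v0 + cnj v1 * v1" unfolding V_def of_real_add cmod_sq ..
  have CV': "complex_of_real V' = cnj v0' * v0' + cnj v1' * v1'" unfolding V'_def of_real_add cmod_sq ..
  \<comment> \<open>The first two equations contract the first qubit of \<open>z\<close> with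
    \<open>u\<close>, the last two with u-perp, which is parallel to \<open>u'\<close>.\<close>
  define P where "P z s r \<longleftrightarrow> cnj u0 * z 0 + cnj u1 * z 2 = - (s * cnj v1) \<and> cnj u0 * z 1 + cnj u1 * z 3 = s * cnj v0 \<and>
     - u1 * z 0 + u0 * z 2 = - (r * cnj v1') \<and> - u1 * z 1 + u0 * z 3 = r * cnj v0'" for z :: "nat \<Rightarrow> complex" and s r
  have PD: "cnj u0 * z 0 + cnj u1 * z 2 = - (s * cnj v1)" "cnj u0 * z 1 + cnj u1 * z 3 = s * cnj v0"
      "- u1 * z 0 + u0 * z 2 = - (r * cnj v1')" "- u1 * z 1 + u0 * z 3 = r * cnj v0'" if "P z s r" for z s r
    using that unfolding P_def by blast+
  have ex: "\<exists>s r. P z s r" if "ip wj z = 0" "ip wk z = 0" for z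
  proof -
    have "cnj v0 * (cnj u0 * z 0 + cnj u1 * z 2) + cnj v1 * (cnj u0 * z 1 + cnj u1 * z 3) = 0"
      using that(1) by (simp add: ip_expand j algebra_simps)
    moreover have "cnj t * (cnj v0' * (- u1 * z 0 + u0 * z 2) + cnj v1' * (- u1 * z 1 + u0 * z 3)) = 0"
      using that(2) by (simp add: ip_expand k t algebra_simps)
    then have "cnj v0' * (- u1 * z 0 + u0 * z 2) + cnj v1' * (- u1 * z 1 + u0 * z 3) = 0"
      using t0 by simp
    ultimately show ?thesis unfolding P_def using perp_parallel[OF v] perp_parallel[OF v'] by meson
  qed
  have det: "U * det4 z = s * r * - K" if "P z s r" for z s r
  proof -
    have "U * det4 z = (cnj u0 * z 0 + cnj u1 * z 2) * (- u1 * z 1 + u0 * z 3)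
        - (cnj u0 * z 1 + cnj u1 * z 3) * (- u1 * z 0 + u0 * z 2)"
      by (simp add: U_def det4_def algebra_simps)
    also have "\<dots> = s * r * - K" unfolding PD[OF that] K_def by (simp add: algebra_simps)
    finally show ?thesis .
  qed
  have prod: "U * ip z z' = cnj s * s' * V + cnj r * r' * V'" if "P z s r" "P z' s' r'" for z z' s r s' r'
  proof -
    have "U * ip z z' = cnj (cnj u0 * z 0 + cnj u1 * z 2) * (cnj u0 * z' 0 + cnj u1 * z' 2)
       + cnj (cnj u0 * z 1 + cnj u1 * z 3) * (cnj u0 * z' 1 + cnj u1 * z' 3)
       + cnj (- u1 * z 0 + u0 * z 2) * (- u1 * z' 0 + u0 * z' 2)
       + cnj (- u1 * z 1 + u0 * z 3) * (- u1 * z' 1 + u0 * z' 3)"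
      by (simp add: U_def ip_expand algebra_simps)
    also have "\<dots> = cnj s * s' * V + cnj r * r' * V'"
      unfolding PD[OF that(1)] PD[OF that(2)] CV CV' by (simp add: algebra_simps)
    finally show ?thesis .
  qed
  obtain s r where sr: "P x s r" using ex[OF x] by blast
  obtain s' r' where sr': "P y s' r'" using ex[OF y] by blast
  define N where "N = (cmod u0)\<^sup>2 + (cmod u1)\<^sup>2"
  have N: "U = of_real N" "N > 0" using UR U0 unfolding N_def by (auto simp: order_less_le)
  have "cnj s * s' * V = - (cnj r * r' * V')" using prod[OF sr sr'] xy by (simp add: eq_neg_iff_add_eq_0)
  then have "cmod (cnj s * s' * V) = cmod (cnj r * r' * V')" by simp
  moreover have "0 \<le> V" "0 \<le> V'" by (auto simp: V_def V'_def)
  \<comment> \<open>This is all that orthogonality of \<open>x\<close> and \<open>y\<close>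
    contributes: it exchanges \<open>V\<close> for \<open>V'\<close> in the cross-multiplied
    claim.\<close>
  ultimately have eq: "cmod s * cmod s' * V = cmod r * cmod r' * V'" by (simp add: norm_mult)
  have n: "N * Re (ip z z) = (cmod s)\<^sup>2 * V + (cmod r)\<^sup>2 * V'" if "P z s r" for z s r
  proof -
    have "complex_of_real (N * Re (ip z z)) = of_real ((cmod s)\<^sup>2 * V + (cmod r)\<^sup>2 * V')"
      using prod[OF that that] unfolding N of_real_add of_real_mult cmod_sq ip_self_real[of z, symmetric] by simp
    then show ?thesis using of_real_eq_iff by blast
  qed
  have d: "N * cmod (det4 z) = cmod s * cmod r * cmod K" if "P z s r" for z s r
    using arg_cong[OF det[OF that], of cmod] N by (simp add: norm_mult)
  have "(N * cmod (det4 x)) * (N * Re (ip y y)) = (N * cmod (det4 y)) * (N * Re (ip x x))"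
  proof -
    have "cmod s * cmod r * ((cmod s')\<^sup>2 * V + (cmod r')\<^sup>2 * V') = cmod s' * cmod r' * ((cmod s)\<^sup>2 * V + (cmod r)\<^sup>2 * V')"
    proof -
      have "cmod s * cmod r * ((cmod s')\<^sup>2 * V + (cmod r')\<^sup>2 * V')
        = (cmod s * cmod s' * V) * (cmod r * cmod s') + cmod s * cmod r' * (cmod r * cmod r' * V')"
        by (simp add: algebra_simps power2_eq_square)
      also have "\<dots> = (cmod r * cmod r' * V') * (cmod r * cmod s') + cmod s * cmod r' * (cmod s * cmod s' * V)"
        unfolding eq ..
      finally show ?thesis by (simp add: algebra_simps power2_eq_square)
    qed
    from arg_cong[OF this, of "(*) (cmod K)"]
    show ?thesis unfolding d[OF sr] d[OF sr'] n[OF sr] n[OF sr'] by (simp add: algebra_simps)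
  qed
  then show ?thesis using N by simp
qed

text \<open>Exchange of the two qubits, that is, of the basis vectors \<open>|01>\<close> and
  \<open>|10>\<close>.\<close>

definition swap4 :: "(nat \<Rightarrow> complex) \<Rightarrow> nat \<Rightarrow> complex" where
  "swap4 x = x (1 := x 2, 2 := x 1)"

text \<open>Orthogonal product vectors are orthogonal in at least one factor; the second factor is
  reduced to the first by \<open>swap4\<close>. The claim says that \<open>x\<close> and
  \<open>y\<close> are equally entangled after normalisation.\<close>

lemma det4_orthogonal_complement:
  assumes dj: "det4 wj = 0" and dk: "det4 wk = 0" and nz: "ip wj wj \<noteq> 0" "ip wk wk \<noteq> 0"
    and jk: "ip wj wk = 0"
    and x: "ip wj x = 0" "ip wk x = 0" and y: "ip wj y = 0" "ip wk y = 0" and xy: "ip x y = 0"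
  shows "cmod (det4 x) * Re (ip y y) = cmod (det4 y) * Re (ip x x)"
proof -
  obtain u0 u1 v0 v1 where j: "wj 0 = u0 * v0" "wj 1 = u0 * v1" "wj 2 = u1 * v0" "wj 3 = u1 * v1"
    using det4_zero_tensor[OF dj] by blast
  obtain u0' u1' v0' v1' where k: "wk 0 = u0' * v0'" "wk 1 = u0' * v1'" "wk 2 = u1' * v0'" "wk 3 = u1' * v1'"
    using det4_zero_tensor[OF dk] by blast
  have nzj: "u0 \<noteq> 0 \<or> u1 \<noteq> 0" "v0 \<noteq> 0 \<or> v1 \<noteq> 0" using nz(1) by (auto simp: ip_expand j)
  have nzk: "u0' \<noteq> 0 \<or> u1' \<noteq> 0" "v0' \<noteq> 0 \<or> v1' \<noteq> 0" using nz(2) by (auto simp: ip_expand k)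
  have "(cnj u0 * u0' + cnj u1 * u1') * (cnj v0 * v0' + cnj v1 * v1') = 0"
    using jk by (simp add: ip_expand j k algebra_simps)
  then consider "cnj u0 * u0' + cnj u1 * u1' = 0" | "cnj v0 * v0' + cnj v1 * v1' = 0" by auto
  then show ?thesis
  proof cases
    case 1
    then show ?thesis by (rule det4_perp_tensors[OF j k nzj nzk _ x y xy])
  next
    case 2
    have sip: "ip (swap4 a) (swap4 b) = ip a b" for a b by (simp add: ip_expand swap4_def)
    have sdet: "det4 (swap4 a) = det4 a" for a by (simp add: det4_def swap4_def)
    have "cmod (det4 (swap4 x)) * Re (ip (swap4 y) (swap4 y)) = cmod (det4 (swap4 y)) * Re (ip (swap4 x) (swap4 x))"
      by (rule det4_perp_tensors[of "swap4 wj" v0 u0 u1 v1 "swap4 wk" v0' u0' u1' v1'])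
        (use j k nzj nzk 2 x y xy in \<open>simp_all add: sip, simp_all add: swap4_def mult.commute\<close>)
    then show ?thesis by (simp add: sip sdet)
  qed
qed

lemma cmod_det_le: "cmod (a * d - b * c) \<le> ((cmod a)\<^sup>2 + (cmod b)\<^sup>2 + (cmod c)\<^sup>2 + (cmod d)\<^sup>2) / 2"
proof -
  have "cmod (a * d - b * c) \<le> cmod a * cmod d + cmod b * cmod c"
    by (metis norm_mult norm_triangle_ineq4)
  also have "\<dots> \<le> ((cmod a)\<^sup>2 + (cmod d)\<^sup>2) / 2 + ((cmod b)\<^sup>2 + (cmod c)\<^sup>2) / 2"
    using sum_squares_bound[of "cmod a" "cmod d"] sum_squares_bound[of "cmod b" "cmod c"] unfolding mult.assoc add_divide_distrib by linarith
  finally show ?thesis by (simp add: field_simps)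
qed

lemma cmod_det_sq_le: "(cmod (a * d - b * c))\<^sup>2 \<le> ((cmod a)\<^sup>2 + (cmod b)\<^sup>2) * ((cmod c)\<^sup>2 + (cmod d)\<^sup>2)"
proof -
  have "(cmod (a * d - b * c))\<^sup>2 \<le> ((cmod a)\<^sup>2 + (cmod b)\<^sup>2) * ((cmod d)\<^sup>2 + (cmod (- c))\<^sup>2)"
    using cmod_sum_mult_le[of "\<lambda>i. if i then a else b" "\<lambda>i. if i then d else - c" UNIV]
    by (simp add: UNIV_bool add.commute)
  then show ?thesis by (simp add: add.commute)
qed

lemma det4_unit_le:
  assumes "ip x x = 1"
  shows "cmod (det4 x) \<le> 1 / 2"
proof -
  have "complex_of_real ((cmod (x 0))\<^sup>2 + (cmod (x 1))\<^sup>2 + (cmod (x 2))\<^sup>2 + (cmod (x 3))\<^sup>2) = 1"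
    using assms unfolding ip_expand of_real_add cmod_sq .
  then have "(cmod (x 0))\<^sup>2 + (cmod (x 1))\<^sup>2 + (cmod (x 2))\<^sup>2 + (cmod (x 3))\<^sup>2 = 1"
    using of_real_eq_1_iff by blast
  then show ?thesis using cmod_det_le[of "x 0" "x 3" "x 1" "x 2"] by (simp add: det4_def)
qed

section \<open>Schmidt weights and overlaps with product vectors\<close>

text \<open>The smaller Schmidt weight of a unit vector whose coefficient matrix has
  determinant of modulus \<open>D\<close>.\<close>

definition schmidt_low :: "real \<Rightarrow> real" where
  "schmidt_low D = (1 - sqrt (1 - 4 * D\<^sup>2)) / 2"

text \<open>The two squared Schmidt coefficients have sum 1 and product \<open>D\<^sup>2\<close>;
  this is the smaller root of the resulting quadratic.\<close>

lemma schmidt_low: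
  assumes "0 \<le> D" "D \<le> 1 / 2"
  shows "0 \<le> schmidt_low D" "schmidt_low D \<le> 1 / 2" "schmidt_low D * (1 - schmidt_low D) = D\<^sup>2"
proof -
  have "D\<^sup>2 \<le> (1 / 2)\<^sup>2" using assms by (intro power_mono) auto
  then have D: "0 \<le> 1 - 4 * D\<^sup>2" by (simp add: power2_eq_square)
  show "0 \<le> schmidt_low D" "schmidt_low D \<le> 1 / 2"
    using D assms by (auto simp: schmidt_low_def)
  have "schmidt_low D * (1 - schmidt_low D) = (1 - (sqrt (1 - 4 * D\<^sup>2))\<^sup>2) / 4"
    by (simp add: schmidt_low_def field_simps power2_eq_square)
  also have "\<dots> = D\<^sup>2" using D by simp
  finally show "schmidt_low D * (1 - schmidt_low D) = D\<^sup>2" .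
qed

text \<open>Let \<open>s\<close> be the weight of \<open>w\<close> on the second-qubit state
  \<open>b\<close>. The overlap with the product vector gives \<open>t\<^sup>2 \<le> s\<close>, and
  the determinant gives \<open>(t * D)\<^sup>2 \<le> s * (t - s)\<close>. Hence
  \<open>q = s / t\<close> is at least \<open>t\<close> and lies between the roots of
  \<open>k * (1 - k) = D\<^sup>2\<close>.\<close>

lemma product_overlap_le:
  assumes psi: "\<psi> 0 = a0 * b0" "\<psi> 1 = a0 * b1" "\<psi> 2 = a1 * b0" "\<psi> 3 = a1 * b1"
    and a: "cnj a0 * a0 + cnj a1 * a1 = 1" and b: "cnj b0 * b0 + cnj b1 * b1 = 1"
    and w: "ip w w = of_real t" "ip \<psi> w = of_real t" "0 < t" "cmod (det4 w) = t * D"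
    and D: "0 \<le> D" "D \<le> 1 / 2"
  shows "t \<le> 1 - schmidt_low D"
proof -
  \<comment> \<open>\<open>m0\<close>, \<open>m1\<close> contract the second qubit of
    \<open>w\<close> with \<open>b\<close>; \<open>l0\<close>, \<open>l1\<close> contract it with
    the orthogonal vector \<open>(- cnj b1, cnj b0)\<close>.\<close>
  define m0 where "m0 = cnj b0 * w 0 + cnj b1 * w 1"
  define m1 where "m1 = cnj b0 * w 2 + cnj b1 * w 3"
  define l0 where "l0 = b0 * w 1 - b1 * w 0"
  define l1 where "l1 = b0 * w 3 - b1 * w 2"
  define s where "s = (cmod m0)\<^sup>2 + (cmod m1)\<^sup>2"
  define s' where "s' = (cmod l0)\<^sup>2 + (cmod l1)\<^sup>2"
  have "complex_of_real ((cmod a0)\<^sup>2 + (cmod a1)\<^sup>2) = 1" using a unfolding of_real_add cmod_sq .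
  then have a1: "(cmod a0)\<^sup>2 + (cmod a1)\<^sup>2 = 1" using of_real_eq_1_iff by blast
  have "complex_of_real (s + s') = (cnj b0 * b0 + cnj b1 * b1) * ip w w"
    unfolding s_def s'_def of_real_add cmod_sq m0_def m1_def l0_def l1_def ip_expand
    by (simp add: algebra_simps)
  then have "complex_of_real (s + s') = of_real t" using b w by simp
  then have ss: "s + s' = t" using of_real_eq_iff by blast
  have "of_real t = cnj a0 * m0 - (- cnj a1) * m1"
    using w(2) by (simp add: psi ip_expand m0_def m1_def algebra_simps)
  then have "(cmod (of_real t))\<^sup>2 \<le> ((cmod (cnj a0))\<^sup>2 + (cmod (- cnj a1))\<^sup>2) * ((cmod m1)\<^sup>2 + (cmod m0)\<^sup>2)"
    using cmod_det_sq_le[of "cnj a0" m0 "- cnj a1" m1] by simp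
  then have ts: "t\<^sup>2 \<le> s" using a1 by (simp add: s_def add.commute)
  have "(cnj b0 * b0 + cnj b1 * b1) * det4 w = m0 * l1 - m1 * l0"
    by (simp add: m0_def m1_def l0_def l1_def det4_def algebra_simps)
  then have "det4 w = m0 * l1 - m1 * l0" using b by simp
  then have "(t * D)\<^sup>2 \<le> s * s'"
    using cmod_det_sq_le[of m0 l1 m1 l0] w(4) by (simp add: s_def s'_def)
  moreover have "t - s = s'" using ss by simp
  ultimately have "t\<^sup>2 * D\<^sup>2 \<le> s * (t - s)" by (simp add: power_mult_distrib)
  define q where "q = s / t"
  have s: "s = t * q" using w by (simp add: q_def)
  have "t\<^sup>2 * D\<^sup>2 \<le> t\<^sup>2 * (q * (1 - q))"
    using \<open>t\<^sup>2 * D\<^sup>2 \<le> s * (t - s)\<close> unfolding s by (simp add: power2_eq_square algebra_simps)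
  then have q: "D\<^sup>2 \<le> q * (1 - q)" using w(3) by simp
  have tq: "t \<le> q" using ts w(3) unfolding s by (simp add: power2_eq_square)
  define k where "k = schmidt_low D"
  note k = schmidt_low[OF D, folded k_def]
  have "q \<le> 1 - k"
  proof (rule ccontr)
    assume "\<not> q \<le> 1 - k"
    \<comment> \<open>Since \<open>k \<le> 1 / 2\<close>, such a \<open>q\<close> exceeds both roots
      \<open>k\<close> and \<open>1 - k\<close>.\<close>
    then have "0 < (q - (1 - k)) * (q - k)" using k by (intro mult_pos_pos) auto
    also have "\<dots> = k * (1 - k) - q * (1 - q)" by (simp add: algebra_simps)
    finally show False using q k by simp
  qed
  then show ?thesis using tq by (simp add: k_def)
qed

lemma det_2x2:
  assumes A: "(A :: complex mat) \<in> carrier_mat 2 2"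
  shows "det A = A $$ (0,0) * A $$ (1,1) - A $$ (0,1) * A $$ (1,0)"
proof -
  have d: "det (mat_delete A i j) = mat_delete A i j $$ (0,0)" for i j
    by (rule det_single) (use A in \<open>auto simp: mat_delete_def\<close>)
  have "det A = (\<Sum>j<2. A $$ (0,j) * cofactor A 0 j)"
    by (rule laplace_expansion_row[OF A]) simp
  also have "\<dots> = A $$ (0,0) * cofactor A 0 0 + A $$ (0,1) * cofactor A 0 1"
    by (simp add: numeral_2_eq_2 One_nat_def)
  also have "\<dots> = A $$ (0,0) * mat_delete A 0 0 $$ (0,0) - A $$ (0,1) * mat_delete A 0 1 $$ (0,0)"
    unfolding cofactor_def d by simp
  also have "mat_delete A 0 0 $$ (0,0) = A $$ (1,1)"
    using A by (auto simp: mat_delete_def One_nat_def)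
  also have "mat_delete A 0 1 $$ (0,0) = A $$ (1,0)"
    using A by (auto simp: mat_delete_def One_nat_def)
  finally show ?thesis .
qed

text \<open>The reduced state has trace 1 and determinant \<open>D\<^sup>2\<close>, so its
  eigenvalues solve \<open>k * (1 - k) = D\<^sup>2\<close>. The smaller root is attained, hence
  \<open>Min\<close> is taken over a nonempty finite set of nonnegative reals.\<close>

lemma lambda_min_sq_le:
  assumes unit: "unit_vec 4 \<Phi>"
  shows "(lambda_min \<Phi>)\<^sup>2 \<le> (schmidt_low (cmod (det4 (($) \<Phi>))))\<^sup>2"
proof -
  define x where "x = (($) \<Phi>)"
  define D where "D = cmod (det4 x)"
  have one: "ip x x = 1" using unit by (auto simp: unit_vec_def braket_def ip_def x_def)
  have D: "0 \<le> D" "D \<le> 1 / 2" using det4_unit_le[OF one] by (auto simp: D_def)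
  define A where "A = coeff_mat \<Phi> * adj (coeff_mat \<Phi>)"
  have A: "A \<in> carrier_mat 2 2"
    unfolding A_def by (rule mult_carrier_mat[of _ 2 2]) (simp_all add: coeff_mat_def adj_def)
  have entry: "A $$ (i,j) = x (2*i) * cnj (x (2*j)) + x (2*i+1) * cnj (x (2*j+1))" if "i < 2" "j < 2" for i j
    using that by (simp add: A_def coeff_mat_def adj_def scalar_prod_def x_def numeral_2_eq_2 One_nat_def)
  have ev: "eigenvalue A k \<longleftrightarrow> k * (1 - k) = of_real (D\<^sup>2)" for k
  proof -
    have c: "char_matrix A k \<in> carrier_mat 2 2" using A by simp
    have "A $$ (0,0) + A $$ (1,1) = 1"
      using one entry[of 0 0] entry[of 1 1] by (simp add: ip_expand algebra_simps)
    then have tr: "A $$ (1,1) = 1 - A $$ (0,0)" by (simp add: algebra_simps)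
    have dA: "A $$ (0,0) * A $$ (1,1) - A $$ (0,1) * A $$ (1,0) = of_real (D\<^sup>2)"
      unfolding D_def cmod_sq by (simp add: entry[of 0 0, simplified] entry[of 0 1, simplified]
        entry[of 1 0, simplified] entry[of 1 1, simplified] det4_def algebra_simps)
    have "det (char_matrix A k) = (A $$ (0,0) - k) * (A $$ (1,1) - k) - A $$ (0,1) * A $$ (1,0)"
      unfolding det_2x2[OF c] using A by (simp add: char_matrix_def)
    also have "\<dots> = of_real (D\<^sup>2) - k * (1 - k)"
      unfolding dA[symmetric] tr by (simp add: algebra_simps)
    finally show ?thesis unfolding eigenvalue_det[OF A] by auto
  qed
  define S where "S = {Re k | k. eigenvalue A k}"
  define k0 where "k0 = schmidt_low D"
  note k0 = schmidt_low[OF D, folded k0_def]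
  have "S \<subseteq> {k0, 1 - k0}"
  proof
    fix r assume "r \<in> S"
    then obtain k where k: "r = Re k" "k * (1 - k) = of_real (D\<^sup>2)" by (auto simp: S_def ev)
    have "(k - of_real k0) * (k - of_real (1 - k0)) = of_real (k0 * (1 - k0)) - k * (1 - k)"
      by (simp add: algebra_simps)
    also have "\<dots> = 0" unfolding k(2) k0(3) by simp
    finally have "k = of_real k0 \<or> k = of_real (1 - k0)" by auto
    then show "r \<in> {k0, 1 - k0}" unfolding k(1) by (elim disjE) simp_all
  qed
  moreover have "k0 \<in> S"
  proof -
    have "complex_of_real k0 * (1 - of_real k0) = of_real (k0 * (1 - k0))" by simp
    then have "eigenvalue A (of_real k0)" unfolding ev k0(3) .
    then show ?thesis unfolding S_def by (auto intro!: exI[of _ "complex_of_real k0"])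
  qed
  ultimately have "Min S \<in> S" "Min S \<le> k0"
    by (auto intro!: Min_in Min_le dest: finite_subset)
  then have "0 \<le> Min S" using \<open>S \<subseteq> {k0, 1 - k0}\<close> k0 by force
  then have "(Min S)\<^sup>2 \<le> k0\<^sup>2" using \<open>Min S \<le> k0\<close> by (intro power_mono)
  then show ?thesis by (simp add: lambda_min_def S_def A_def k0_def D_def x_def)
qed

section \<open>LOCC protocols\<close>

lemma dim_adj [simp]: "dim_row (adj A) = dim_col A" "dim_col (adj A) = dim_row A"
  by (simp_all add: adj_def)

lemma adj_mult:
  assumes "dim_col A = dim_row B"
  shows "adj (A * B) = adj B * adj A"
  by (rule eq_matI) (use assms in \<open>simp_all add: adj_def scalar_prod_def mult.commute\<close>)

lemma msum_carrier: "(\<And>M. M \<in> set Ms \<Longrightarrow> M \<in> carrier_mat d d) \<Longrightarrow> msum d Ms \<in> carrier_mat d d"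
  by (induction Ms) (auto simp: msum_def)

lemma msum_index:
  assumes "\<And>M. M \<in> set Ms \<Longrightarrow> M \<in> carrier_mat d d" "r < d" "s < d"
  shows "msum d Ms $$ (r,s) = (\<Sum>M\<leftarrow>Ms. M $$ (r,s))"
  using assms
proof (induction Ms)
  case (Cons M Ms)
  then have "msum d Ms \<in> carrier_mat d d" by (intro msum_carrier) auto
  then show ?case using Cons by (simp add: msum_def)
qed (simp add: msum_def)

lemma mult_mat_vec_carrier_dim [simp]: "A *\<^sub>v x \<in> carrier_vec (dim_row A)"
  by (rule carrier_vecI) simp

text \<open>Otherwise every \<open>adj K * K\<close> would annihilate \<open>u\<close>, and so would
  their sum, the identity. This is what carries information through a local round.\<close>

lemma kraus_nonzero:
  assumes dims: "\<forall>K\<in>set Ks. dim_col K = d"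
    and complete: "msum d (map (\<lambda>K. adj K * K) Ks) = 1\<^sub>m d"
    and u: "u \<in> carrier_vec d" "u \<noteq> 0\<^sub>v d"
  shows "\<exists>K\<in>set Ks. K *\<^sub>v u \<noteq> 0\<^sub>v (dim_row K)"
proof (rule ccontr)
  assume "\<not> ?thesis"
  then have zero: "\<forall>K\<in>set Ks. dim_col K = d \<and> K *\<^sub>v u = 0\<^sub>v (dim_row K)" using dims by auto
  then have "msum d (map (\<lambda>K. adj K * K) Ks) *\<^sub>v u = 0\<^sub>v d"
  proof (induction Ks)
    case Nil
    then show ?case using u by (auto simp: msum_def scalar_prod_def intro!: eq_vecI)
  next
    case (Cons K Ks)
    have K: "adj K * K \<in> carrier_mat d d" using Cons.prems by auto
    have M: "msum d (map (\<lambda>K. adj K * K) Ks) \<in> carrier_mat d d"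
      using Cons.prems by (intro msum_carrier) auto
    have "(adj K * K) *\<^sub>v u = adj K *\<^sub>v (K *\<^sub>v u)"
      using Cons.prems u by (intro assoc_mult_mat_vec[of _ d "dim_row K" _ d]) auto
    also have "\<dots> = 0\<^sub>v d" using Cons.prems by (auto simp: adj_def)
    finally show ?case
      using Cons K M u by (simp add: msum_def add_mult_distrib_mat_vec[of _ d d])
  qed
  then show False using complete u by simp
qed

text \<open>Completeness is not inherited by sublists, so the induction keeps the partial sum
  \<open>msum\<close> in the middle; it becomes the identity only where the lemma is
  applied.\<close>

lemma kraus_gram_sum:
  assumes dims: "\<forall>K\<in>set Ks. dim_col K = dim_row A" and ab: "a < dim_col A" "b < dim_col A"
  shows "(\<Sum>K\<leftarrow>Ks. (adj (K * A) * (K * A)) $$ (a,b))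
    = (adj A * (msum (dim_row A) (map (\<lambda>K. adj K * K) Ks) * A)) $$ (a,b)"
  using dims
proof (induction Ks)
  case Nil
  have "0\<^sub>m (dim_row A) (dim_row A) * A = 0\<^sub>m (dim_row A) (dim_col A)" by simp
  moreover have "adj A * 0\<^sub>m (dim_row A) (dim_col A) = 0\<^sub>m (dim_col A) (dim_col A)"
    by (rule right_mult_zero_mat) (auto simp: adj_def)
  ultimately show ?case using ab by (simp add: msum_def)
next
  case (Cons K Ks)
  let ?d = "dim_row A" and ?c = "dim_col A"
  let ?M = "msum ?d (map (\<lambda>K. adj K * K) Ks)"
  have M: "?M \<in> carrier_mat ?d ?d" using Cons.prems by (intro msum_carrier) auto
  have K: "K \<in> carrier_mat (dim_row K) ?d" "adj K \<in> carrier_mat ?d (dim_row K)" using Cons.prems by auto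
  have A: "A \<in> carrier_mat ?d ?c" "adj A \<in> carrier_mat ?c ?d" by auto
  note KK = mult_carrier_mat[OF K(2,1)] and KA = mult_carrier_mat[OF K(1) A(1)]
  have "adj (K * A) * (K * A) = adj A * ((adj K * K) * A)"
    unfolding adj_mult[OF carrier_matD(2)[OF K(1)]] assoc_mult_mat[OF A(2) K(2) KA] assoc_mult_mat[OF K(2,1) A(1)] ..
  moreover have "adj A * ((adj K * K + ?M) * A) = adj A * ((adj K * K) * A) + adj A * (?M * A)"
    unfolding add_mult_distrib_mat[OF KK M A(1)]
    by (rule mult_add_distrib_mat[OF A(2) mult_carrier_mat[OF KK A(1)] mult_carrier_mat[OF M A(1)]])
  moreover have "adj A * (?M * A) \<in> carrier_mat ?c ?c"
    by (rule mult_carrier_mat[OF A(2) mult_carrier_mat[OF M A(1)]])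
  ultimately show ?case using Cons ab by (simp add: msum_def del: index_mult_mat(1))
qed

lemma locc_tree_dims:
  assumes "Ls \<in> locc_tree" "L \<in> set Ls"
  shows "dim_col (fst L) = 2 \<and> dim_col (snd L) = 2"
  using assms
proof (induction arbitrary: L)
  case (stepA Ls m A B Ks)
  have "(A, B) \<in> set Ls" using stepA(2,3) nth_mem by metis
  then show ?case using stepA.IH[of "(A,B)"] stepA.IH[of L] stepA.prems by (auto dest: in_set_takeD in_set_dropD)
next
  case (stepB Ls m A B Ks)
  have "(A, B) \<in> set Ls" using stepB(2,3) nth_mem by metis
  then show ?case using stepB.IH[of "(A,B)"] stepB.IH[of L] stepB.prems by (auto dest: in_set_takeD in_set_dropD)
qed simp

lemma leaf_effect_index:
  assumes "dim_col A = 2" "dim_col B = 2" "i < 4" "j < 4"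
  shows "leaf_effect (A, B) $$ (i,j) = (adj A * A) $$ (i div 2, j div 2) * (adj B * B) $$ (i mod 2, j mod 2)"
  using assms by (simp add: leaf_effect_def kron_def)

text \<open>A round replaces one leaf by children whose effects add up to the effect of that leaf,
  so the total stays the identity.\<close>

lemma locc_tree_sum:
  assumes "Ls \<in> locc_tree" "i < 4" "j < 4"
  shows "(\<Sum>L\<leftarrow>Ls. leaf_effect L $$ (i,j)) = (if i = j then 1 else 0)"
  using assms(1)
proof induction
  case start
  have "i div 2 < 2" "j div 2 < 2" using assms by auto
  moreover have "i = j" if "i div 2 = j div 2" "i mod 2 = j mod 2" using that by (metis div_mult_mod_eq)
  moreover have "adj (1\<^sub>m 2) = 1\<^sub>m 2" by (rule eq_matI) (auto simp: adj_def)
  ultimately show ?case using assms by (auto simp: leaf_effect_index)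
next
  case (stepA Ls m A B Ks)
  have AB: "(A, B) \<in> set Ls" using stepA(2,3) nth_mem by metis
  then have dim: "dim_col A = 2" "dim_col B = 2" using locc_tree_dims[OF stepA(1)] by auto
  have ij: "i div 2 < dim_col A" "j div 2 < dim_col A" using assms dim by auto
  have "(\<Sum>L\<leftarrow>map (\<lambda>K. (K * A, B)) Ks. leaf_effect L $$ (i,j))
    = (\<Sum>K\<leftarrow>Ks. (adj (K * A) * (K * A)) $$ (i div 2, j div 2)) * (adj B * B) $$ (i mod 2, j mod 2)"
    using assms dim by (simp add: leaf_effect_index o_def sum_list_mult_const)
  also have "\<dots> = leaf_effect (A, B) $$ (i,j)"
    unfolding kraus_gram_sum[OF stepA(5) ij]
    using assms dim stepA(6) by (simp add: leaf_effect_index del: index_mult_mat(1))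
  finally have *: "(\<Sum>L\<leftarrow>map (\<lambda>K. (K * A, B)) Ks. leaf_effect L $$ (i,j)) = leaf_effect (Ls ! m) $$ (i,j)"
    using stepA(3) by simp
  have "(\<Sum>L\<leftarrow>Ls. leaf_effect L $$ (i,j)) = (\<Sum>L\<leftarrow>take m Ls @ Ls ! m # drop (Suc m) Ls. leaf_effect L $$ (i,j))"
    using id_take_nth_drop[OF stepA(2)] by simp
  then show ?case using stepA.IH * by simp
next
  case (stepB Ls m A B Ks)
  have AB: "(A, B) \<in> set Ls" using stepB(2,3) nth_mem by metis
  then have dim: "dim_col A = 2" "dim_col B = 2" using locc_tree_dims[OF stepB(1)] by auto
  have ij: "i mod 2 < dim_col B" "j mod 2 < dim_col B" using assms dim by auto
  have "(\<Sum>L\<leftarrow>map (\<lambda>K. (A, K * B)) Ks. leaf_effect L $$ (i,j))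
    = (adj A * A) $$ (i div 2, j div 2) * (\<Sum>K\<leftarrow>Ks. (adj (K * B) * (K * B)) $$ (i mod 2, j mod 2))"
    using assms dim by (simp add: leaf_effect_index o_def sum_list_const_mult)
  also have "\<dots> = leaf_effect (A, B) $$ (i,j)"
    unfolding kraus_gram_sum[OF stepB(5) ij]
    using assms dim stepB(6) by (simp add: leaf_effect_index del: index_mult_mat(1))
  finally have *: "(\<Sum>L\<leftarrow>map (\<lambda>K. (A, K * B)) Ks. leaf_effect L $$ (i,j)) = leaf_effect (Ls ! m) $$ (i,j)"
    using stepB(3) by simp
  have "(\<Sum>L\<leftarrow>Ls. leaf_effect L $$ (i,j)) = (\<Sum>L\<leftarrow>take m Ls @ Ls ! m # drop (Suc m) Ls. leaf_effect L $$ (i,j))"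
    using id_take_nth_drop[OF stepB(2)] by simp
  then show ?case using stepB.IH * by simp
qed

section \<open>Loss of rank along a protocol\<close>

definition inj2 :: "complex mat \<Rightarrow> bool" where
  "inj2 A \<longleftrightarrow> (\<forall>z\<in>carrier_vec 2. z \<noteq> 0\<^sub>v 2 \<longrightarrow> A *\<^sub>v z \<noteq> 0\<^sub>v (dim_row A))"

text \<open>A record of the moment a party's operator first loses rank: two distinct kernel
  directions occur on that party's side, each accompanied on the other side by leaves that
  jointly annihilate no vector. Unlike the protocol node itself this survives all later rounds.\<close>

definition ray_split :: "(complex mat \<times> complex mat) set \<Rightarrow> complex vec \<Rightarrow> bool" where
  "ray_split S z \<longleftrightarrow> (\<forall>y\<in>carrier_vec 2. y \<noteq> 0\<^sub>v 2 \<longrightarrow>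
     (\<exists>(A, B)\<in>S. A *\<^sub>v z = 0\<^sub>v (dim_row A) \<and> (\<exists>x\<in>carrier_vec 2. A *\<^sub>v x \<noteq> 0\<^sub>v (dim_row A))
        \<and> B *\<^sub>v y \<noteq> 0\<^sub>v (dim_row B)))"

definition rank_split :: "(complex mat \<times> complex mat) set \<Rightarrow> bool" where
  "rank_split S \<longleftrightarrow> (\<exists>z\<in>carrier_vec 2. \<exists>z'\<in>carrier_vec 2. z $ 0 * z' $ 1 \<noteq> z $ 1 * z' $ 0 \<and>
     ray_split S z \<and> ray_split S z')"

lemma mult_mat_zero_vec: "dim_col K = d \<Longrightarrow> K *\<^sub>v 0\<^sub>v d = 0\<^sub>v (dim_row K)" for K :: "complex mat"
  by auto

lemma smult_zero_vec: "c \<cdot>\<^sub>v 0\<^sub>v d = 0\<^sub>v d" for c :: complex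
  by auto

lemma kraus_mult_vec:
  fixes K A :: "complex mat"
  assumes "dim_col K = dim_row A" "dim_col A = 2" "z \<in> carrier_vec 2"
  shows "K * A *\<^sub>v z = K *\<^sub>v (A *\<^sub>v z)"
  by (rule assoc_mult_mat_vec[of _ "dim_row K" "dim_row A" _ 2]) (use assms in auto)

text \<open>A further operator \<open>K\<close> keeps \<open>z\<close> in the kernel. By
  completeness some \<open>K\<close> does not annihilate the nonzero vector \<open>A x\<close>, so a
  child with nonzero first operator remains.\<close>

lemma ray_split_step_fst:
  assumes split: "ray_split S z" and z: "z \<in> carrier_vec 2" and A: "dim_col A = 2"
    and dims: "\<forall>K\<in>set Ks. dim_col K = dim_row A"
    and complete: "msum (dim_row A) (map (\<lambda>K. adj K * K) Ks) = 1\<^sub>m (dim_row A)"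
    and S': "S - {(A, B)} \<subseteq> S'" "(\<lambda>K. (K * A, B)) ` set Ks \<subseteq> S'"
  shows "ray_split S' z"
  unfolding ray_split_def
proof (intro ballI impI)
  fix y :: "complex vec"
  assume "y \<in> carrier_vec 2" "y \<noteq> 0\<^sub>v 2"
  then obtain C D x where CD: "(C, D) \<in> S" "C *\<^sub>v z = 0\<^sub>v (dim_row C)" "D *\<^sub>v y \<noteq> 0\<^sub>v (dim_row D)"
      and x: "x \<in> carrier_vec 2" "C *\<^sub>v x \<noteq> 0\<^sub>v (dim_row C)"
    using split unfolding ray_split_def by blast
  show "\<exists>(A, B)\<in>S'. A *\<^sub>v z = 0\<^sub>v (dim_row A) \<and> (\<exists>x\<in>carrier_vec 2. A *\<^sub>v x \<noteq> 0\<^sub>v (dim_row A))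
        \<and> B *\<^sub>v y \<noteq> 0\<^sub>v (dim_row B)"
  proof (cases "(C, D) = (A, B)")
    case False
    then have "(C, D) \<in> S'" using CD S' by blast
    then show ?thesis using CD x by blast
  next
    case True
    then obtain K where K: "K \<in> set Ks" "K *\<^sub>v (A *\<^sub>v x) \<noteq> 0\<^sub>v (dim_row K)"
      using kraus_nonzero[OF dims complete, of "A *\<^sub>v x"] x by auto
    have "(K * A, B) \<in> S'" using K S' by blast
    moreover have "K * A *\<^sub>v z = 0\<^sub>v (dim_row (K * A))"
      using True CD dims K A z by (simp add: kraus_mult_vec mult_mat_zero_vec)
    moreover have "K * A *\<^sub>v x \<noteq> 0\<^sub>v (dim_row (K * A))"
      using dims K A x by (simp add: kraus_mult_vec)
    ultimately show ?thesis using True CD x by blast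
  qed
qed

text \<open>Completeness is now applied to \<open>B y\<close>. The surviving child depends on
  \<open>y\<close>, which is why \<open>ray_split\<close> chooses its leaf after
  \<open>y\<close>.\<close>

lemma ray_split_step_snd:
  assumes split: "ray_split S z" and B: "dim_col B = 2"
    and dims: "\<forall>K\<in>set Ks. dim_col K = dim_row B"
    and complete: "msum (dim_row B) (map (\<lambda>K. adj K * K) Ks) = 1\<^sub>m (dim_row B)"
    and S': "S - {(A, B)} \<subseteq> S'" "(\<lambda>K. (A, K * B)) ` set Ks \<subseteq> S'"
  shows "ray_split S' z"
  unfolding ray_split_def
proof (intro ballI impI)
  fix y :: "complex vec"
  assume y: "y \<in> carrier_vec 2" "y \<noteq> 0\<^sub>v 2"
  then obtain C D x where CD: "(C, D) \<in> S" "C *\<^sub>v z = 0\<^sub>v (dim_row C)" "D *\<^sub>v y \<noteq> 0\<^sub>v (dim_row D)"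
      and x: "x \<in> carrier_vec 2" "C *\<^sub>v x \<noteq> 0\<^sub>v (dim_row C)"
    using split unfolding ray_split_def by blast
  show "\<exists>(A, B)\<in>S'. A *\<^sub>v z = 0\<^sub>v (dim_row A) \<and> (\<exists>x\<in>carrier_vec 2. A *\<^sub>v x \<noteq> 0\<^sub>v (dim_row A))
        \<and> B *\<^sub>v y \<noteq> 0\<^sub>v (dim_row B)"
  proof (cases "(C, D) = (A, B)")
    case False
    then have "(C, D) \<in> S'" using CD S' by blast
    then show ?thesis using CD x by blast
  next
    case True
    then obtain K where K: "K \<in> set Ks" "K *\<^sub>v (B *\<^sub>v y) \<noteq> 0\<^sub>v (dim_row K)"
      using kraus_nonzero[OF dims complete, of "B *\<^sub>v y"] CD by auto
    have "(A, K * B) \<in> S'" using K S' by blast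
    moreover have "K * B *\<^sub>v y \<noteq> 0\<^sub>v (dim_row (K * B))"
      using dims K B y by (simp add: kraus_mult_vec)
    ultimately show ?thesis using True CD x by blast
  qed
qed

lemma rank_split_step_fst:
  assumes "rank_split S" "dim_col A = 2" "\<forall>K\<in>set Ks. dim_col K = dim_row A"
    "msum (dim_row A) (map (\<lambda>K. adj K * K) Ks) = 1\<^sub>m (dim_row A)"
    "S - {(A, B)} \<subseteq> S'" "(\<lambda>K. (K * A, B)) ` set Ks \<subseteq> S'"
  shows "rank_split S'"
  using assms(1) ray_split_step_fst[OF _ _ assms(2-6)] unfolding rank_split_def by blast

lemma rank_split_step_snd:
  assumes "rank_split S" "dim_col B = 2" "\<forall>K\<in>set Ks. dim_col K = dim_row B"
    "msum (dim_row B) (map (\<lambda>K. adj K * K) Ks) = 1\<^sub>m (dim_row B)"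
    "S - {(A, B)} \<subseteq> S'" "(\<lambda>K. (A, K * B)) ` set Ks \<subseteq> S'"
  shows "rank_split S'"
  using assms(1) ray_split_step_snd[OF _ assms(2-6)] unfolding rank_split_def by blast

lemma vec2_eqI: "x \<in> carrier_vec 2 \<Longrightarrow> y \<in> carrier_vec 2 \<Longrightarrow> x $ 0 = y $ 0 \<Longrightarrow> x $ 1 = y $ 1 \<Longrightarrow> x = y"
  by (rule eq_vecI) (auto simp: less_2_cases_iff One_nat_def)

lemma parallel_vec2:
  fixes x y :: "complex vec"
  assumes xy: "x \<in> carrier_vec 2" "y \<in> carrier_vec 2" and x0: "x \<noteq> 0\<^sub>v 2" and d: "x $ 0 * y $ 1 = x $ 1 * y $ 0"
  shows "\<exists>c. y = c \<cdot>\<^sub>v x"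
proof -
  have "x $ 0 \<noteq> 0 \<or> x $ 1 \<noteq> 0" using vec2_eqI[OF xy(1), of "0\<^sub>v 2"] x0 by auto
  then show ?thesis
  proof
    assume "x $ 0 \<noteq> 0"
    then show ?thesis using d xy
      by (intro exI[of _ "y $ 0 / x $ 0"] vec2_eqI) (auto simp: field_simps)
  next
    assume "x $ 1 \<noteq> 0"
    then show ?thesis using d xy
      by (intro exI[of _ "y $ 1 / x $ 1"] vec2_eqI) (auto simp: field_simps)
  qed
qed

text \<open>Every child has a kernel direction, but no nonzero vector is annihilated by all
  children. So the kernel vector \<open>z\<close> of one child survives in another child, whose own
  kernel vector \<open>z'\<close> cannot be parallel to \<open>z\<close>; the injective
  \<open>B\<close> annihilates no nonzero \<open>y\<close>.\<close>

lemma rank_split_start: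
  assumes A: "inj2 A" "dim_col A = 2" and B: "inj2 B"
    and dims: "\<forall>K\<in>set Ks. dim_col K = dim_row A"
    and complete: "msum (dim_row A) (map (\<lambda>K. adj K * K) Ks) = 1\<^sub>m (dim_row A)"
    and S': "(\<lambda>K. (K * A, B)) ` set Ks \<subseteq> S'" and sing: "\<And>K. K \<in> set Ks \<Longrightarrow> \<not> inj2 (K * A)"
  shows "rank_split S'"
proof -
  have nz: "\<exists>K\<in>set Ks. K * A *\<^sub>v x \<noteq> 0\<^sub>v (dim_row (K * A))" if x: "x \<in> carrier_vec 2" "x \<noteq> 0\<^sub>v 2" for x
  proof -
    have "A *\<^sub>v x \<noteq> 0\<^sub>v (dim_row A)" using A x by (auto simp: inj2_def)
    then obtain K where "K \<in> set Ks" "K *\<^sub>v (A *\<^sub>v x) \<noteq> 0\<^sub>v (dim_row K)"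
      using kraus_nonzero[OF dims complete, of "A *\<^sub>v x"] x by auto
    then show ?thesis using dims A x by (intro bexI[of _ K]) (auto simp: kraus_mult_vec)
  qed
  have ker: "\<exists>z\<in>carrier_vec 2. z \<noteq> 0\<^sub>v 2 \<and> K * A *\<^sub>v z = 0\<^sub>v (dim_row (K * A))" if "K \<in> set Ks" for K
    using sing[OF that] by (auto simp: inj2_def)
  have ray: "ray_split S' z" if K: "K \<in> set Ks" and x: "x \<in> carrier_vec 2" "K * A *\<^sub>v x \<noteq> 0\<^sub>v (dim_row (K * A))"
      and z: "K * A *\<^sub>v z = 0\<^sub>v (dim_row (K * A))" for K x z
    unfolding ray_split_def
  proof (intro ballI impI)
    fix y :: "complex vec"
    assume "y \<in> carrier_vec 2" "y \<noteq> 0\<^sub>v 2"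
    then have "B *\<^sub>v y \<noteq> 0\<^sub>v (dim_row B)" using B by (auto simp: inj2_def)
    then show "\<exists>(A, B)\<in>S'. A *\<^sub>v z = 0\<^sub>v (dim_row A) \<and> (\<exists>x\<in>carrier_vec 2. A *\<^sub>v x \<noteq> 0\<^sub>v (dim_row A))
        \<and> B *\<^sub>v y \<noteq> 0\<^sub>v (dim_row B)"
      using K x z S' by (intro bexI[of _ "(K * A, B)"]) auto
  qed
  \<comment> \<open>Any nonzero vector would do: it serves to select a child that is not the zero
    operator.\<close>
  define e :: "complex vec" where "e = vec 2 (\<lambda>i. 1)"
  have "e $ 0 \<noteq> 0\<^sub>v 2 $ 0" by (simp add: e_def)
  then have e: "e \<in> carrier_vec 2" "e \<noteq> 0\<^sub>v 2" by (simp add: e_def, metis)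
  obtain K where K: "K \<in> set Ks" "K * A *\<^sub>v e \<noteq> 0\<^sub>v (dim_row (K * A))" using nz[OF e] by blast
  obtain z where z: "z \<in> carrier_vec 2" "z \<noteq> 0\<^sub>v 2" "K * A *\<^sub>v z = 0\<^sub>v (dim_row (K * A))" using ker[OF K(1)] by blast
  obtain K' where K': "K' \<in> set Ks" "K' * A *\<^sub>v z \<noteq> 0\<^sub>v (dim_row (K' * A))" using nz[OF z(1,2)] by blast
  obtain z' where z': "z' \<in> carrier_vec 2" "z' \<noteq> 0\<^sub>v 2" "K' * A *\<^sub>v z' = 0\<^sub>v (dim_row (K' * A))" using ker[OF K'(1)] by blast
  have "z $ 0 * z' $ 1 \<noteq> z $ 1 * z' $ 0"
  proof
    assume "z $ 0 * z' $ 1 = z $ 1 * z' $ 0"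
    then have "z' $ 0 * z $ 1 = z' $ 1 * z $ 0" by (simp add: mult.commute)
    then obtain c where c: "z = c \<cdot>\<^sub>v z'" using parallel_vec2[OF z'(1) z(1) z'(2)] by blast
    have "K' * A *\<^sub>v z = c \<cdot>\<^sub>v (K' * A *\<^sub>v z')"
      unfolding c by (rule mult_mat_vec[of _ "dim_row K'" 2]) (use z' A in auto)
    then show False using K'(2) z'(3) by (simp add: smult_zero_vec)
  qed
  then show ?thesis unfolding rank_split_def
    using ray[OF K(1) e(1) K(2) z(3)] ray[OF K'(1) z(1) K'(2) z'(3)] z(1) z'(1) by blast
qed

lemma set_replace_nth:
  assumes "m < length Ls"
  shows "set Ls - {Ls ! m} \<subseteq> set (take m Ls @ cs @ drop (Suc m) Ls)"
    "set cs \<subseteq> set (take m Ls @ cs @ drop (Suc m) Ls)"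
proof -
  have "set Ls = set (take m Ls @ Ls ! m # drop (Suc m) Ls)" using id_take_nth_drop[OF assms] by simp
  then show "set Ls - {Ls ! m} \<subseteq> set (take m Ls @ cs @ drop (Suc m) Ls)" by auto
qed auto

lemma swap_diff_subset: "S - {(A, B)} \<subseteq> S' \<Longrightarrow> prod.swap ` S - {(B, A)} \<subseteq> prod.swap ` S'"
  by force

lemma swap_image_subset: "(\<lambda>K. (g K, h K)) ` T \<subseteq> S' \<Longrightarrow> (\<lambda>K. (h K, g K)) ` T \<subseteq> prod.swap ` S'"
  by force

text \<open>The invariant of a protocol: a leaf of full rank on both sides persists until all its
  children are singular, and that moment creates a split that later rounds preserve. The swapped set
  records a loss on the second side.\<close>

lemma locc_tree_split:
  assumes "Ls \<in> locc_tree"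
  shows "(\<exists>(A, B)\<in>set Ls. inj2 A \<and> inj2 B) \<or> rank_split (set Ls) \<or> rank_split (prod.swap ` set Ls)"
  using assms
proof induction
  case start
  have "inj2 (1\<^sub>m 2)" by (auto simp: inj2_def)
  then show ?case by simp
next
  case (stepA Ls m A B Ks)
  let ?S = "set (take m Ls @ map (\<lambda>K. (K * A, B)) Ks @ drop (Suc m) Ls)"
  have "(A, B) \<in> set Ls" using stepA(2,3) nth_mem by metis
  then have dim: "dim_col A = 2" "dim_col B = 2" using locc_tree_dims[OF stepA(1)] by auto
  have S: "set Ls - {(A, B)} \<subseteq> ?S" "(\<lambda>K. (K * A, B)) ` set Ks \<subseteq> ?S"
    using set_replace_nth[OF stepA(2)] stepA(3) by (metis, force)
  have S2: "prod.swap ` set Ls - {(B, A)} \<subseteq> prod.swap ` ?S" "(\<lambda>K. (B, K * A)) ` set Ks \<subseteq> prod.swap ` ?S"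
    by (rule swap_diff_subset[OF S(1)], rule swap_image_subset[OF S(2)])
  from stepA.IH consider (full) C D where "(C, D) \<in> set Ls" "inj2 C" "inj2 D"
    | (fst) "rank_split (set Ls)" | (snd) "rank_split (prod.swap ` set Ls)" by blast
  then show ?case
  proof cases
    case full
    show ?thesis
    proof (cases "(C, D) = (A, B)")
      case False
      then show ?thesis using full S by blast
    next
      case True
      then have AB: "inj2 A" "inj2 B" using full by auto
      show ?thesis
      proof (cases "\<exists>K\<in>set Ks. inj2 (K * A)")
        case True
        then show ?thesis using S AB by blast
      next
        case False
        then show ?thesis using rank_split_start[OF AB(1) dim(1) AB(2) stepA(5,6) S(2)] by blast
      qed
    qed
  next
    case fst
    then show ?thesis using rank_split_step_fst[OF _ dim(1) stepA(5,6) S] by blast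
  next
    case snd
    then show ?thesis using rank_split_step_snd[OF _ dim(1) stepA(5,6) S2] by blast
  qed
next
  case (stepB Ls m A B Ks)
  let ?S = "set (take m Ls @ map (\<lambda>K. (A, K * B)) Ks @ drop (Suc m) Ls)"
  have "(A, B) \<in> set Ls" using stepB(2,3) nth_mem by metis
  then have dim: "dim_col A = 2" "dim_col B = 2" using locc_tree_dims[OF stepB(1)] by auto
  have S: "set Ls - {(A, B)} \<subseteq> ?S" "(\<lambda>K. (A, K * B)) ` set Ks \<subseteq> ?S"
    using set_replace_nth[OF stepB(2)] stepB(3) by (metis, force)
  have S2: "prod.swap ` set Ls - {(B, A)} \<subseteq> prod.swap ` ?S" "(\<lambda>K. (K * B, A)) ` set Ks \<subseteq> prod.swap ` ?S"
    by (rule swap_diff_subset[OF S(1)], rule swap_image_subset[OF S(2)])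
  from stepB.IH consider (full) C D where "(C, D) \<in> set Ls" "inj2 C" "inj2 D"
    | (fst) "rank_split (set Ls)" | (snd) "rank_split (prod.swap ` set Ls)" by blast
  then show ?case
  proof cases
    case full
    show ?thesis
    proof (cases "(C, D) = (A, B)")
      case False
      then show ?thesis using full S by blast
    next
      case True
      then have AB: "inj2 A" "inj2 B" using full by auto
      show ?thesis
      proof (cases "\<exists>K\<in>set Ks. inj2 (K * B)")
        case True
        then show ?thesis using S AB by blast
      next
        case False
        then show ?thesis using rank_split_start[OF AB(2) dim(2) AB(1) stepB(5,6) S2(2)] by blast
      qed
    qed
  next
    case fst
    then show ?thesis using rank_split_step_snd[OF _ dim(2) stepB(5,6) S] by blast
  next
    case snd
    then show ?thesis using rank_split_step_fst[OF _ dim(2) stepB(5,6) S2] by blast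
  qed
qed

section \<open>Error-free discrimination of three vectors\<close>

text \<open>\<open>W j\<close> is the coefficient matrix of the \<open>j\<close>-th of three orthogonal vectors.\<close>

definition unambiguous :: "(complex mat \<times> complex mat) set \<Rightarrow> (nat \<Rightarrow> nat \<Rightarrow> nat \<Rightarrow> complex) \<Rightarrow> bool" where
  "unambiguous S W \<longleftrightarrow> (\<forall>(A, B)\<in>S. dim_col A = 2 \<and> dim_col B = 2 \<and> (\<exists>i<3. \<forall>j<3. j \<noteq> i \<longrightarrow>
     (\<forall>r<dim_row A. \<forall>s<dim_row B. (\<Sum>a<2. \<Sum>b<2. A $$ (r,a) * B $$ (s,b) * W j a b) = 0)))"

lemma unambiguousD:
  assumes "unambiguous S W" "(A, B) \<in> S"
  shows "\<exists>i<3. \<forall>j<3. j \<noteq> i \<longrightarrow>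
     (\<forall>r<dim_row A. \<forall>s<dim_row B. (\<Sum>a<2. \<Sum>b<2. A $$ (r,a) * B $$ (s,b) * W j a b) = 0)"
  using bspec[OF assms(1)[unfolded unambiguous_def] assms(2)] by simp

lemma sum2: "(\<Sum>a<2. g a) = g 0 + g (1::nat)" for g :: "nat \<Rightarrow> 'a::comm_monoid_add"
  by (simp add: numeral_2_eq_2 One_nat_def)

lemma mult_mat_vec2_index:
  "dim_col A = 2 \<Longrightarrow> z \<in> carrier_vec 2 \<Longrightarrow> r < dim_row A \<Longrightarrow> (A *\<^sub>v z) $ r = A $$ (r,0) * z $ 0 + A $$ (r,1) * z $ 1"
  for A :: "complex mat"
  by (auto simp: scalar_prod_def numeral_2_eq_2 One_nat_def)

lemma mult_mat_vec2_zero_iff: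
  "dim_col A = 2 \<Longrightarrow> z \<in> carrier_vec 2 \<Longrightarrow> A *\<^sub>v z = 0\<^sub>v (dim_row A) \<longleftrightarrow>
     (\<forall>r<dim_row A. A $$ (r,0) * z $ 0 + A $$ (r,1) * z $ 1 = 0)"
  for A :: "complex mat"
  by (auto simp: vec_eq_iff mult_mat_vec2_index simp del: index_mult_mat_vec)

lemma unambiguous_swap:
  assumes "unambiguous S W"
  shows "unambiguous (prod.swap ` S) (\<lambda>j a b. W j b a)"
  using assms unfolding unambiguous_def
  by (fastforce simp: sum2 algebra_simps)

text \<open>Each leaf annihilates at least two of the three nonzero vectors, which a tensor product
  of injective operators cannot do. The two factors are stripped off one after the other.\<close>

lemma unambiguous_not_inj:
  assumes un: "unambiguous S W" and AB: "(A, B) \<in> S" "inj2 A" "inj2 B"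
    and nz: "\<And>j. j < 3 \<Longrightarrow> \<exists>a<2. \<exists>b<2. W j a b \<noteq> 0"
  shows False
proof -
  have dim: "dim_col A = 2" "dim_col B = 2" using un AB by (auto simp: unambiguous_def)
  obtain i where i: "\<And>j r s. j < 3 \<Longrightarrow> j \<noteq> i \<Longrightarrow> r < dim_row A \<Longrightarrow> s < dim_row B \<Longrightarrow>
     (\<Sum>a<2. \<Sum>b<2. A $$ (r,a) * B $$ (s,b) * W j a b) = 0"
    using unambiguousD[OF un AB(1)] by meson
  define j :: nat where "j = (if i = 0 then 1 else 0)"
  have j: "j < 3" "j \<noteq> i" by (auto simp: j_def)
  have inner: "(\<Sum>b<2. B $$ (s,b) * W j a b) = 0" if s: "s < dim_row B" and a: "a < 2" for s a
  proof -
    define z where "z = vec 2 (\<lambda>a. \<Sum>b<2. B $$ (s,b) * W j a b)"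
    have "A *\<^sub>v z = 0\<^sub>v (dim_row A)"
      using i[OF j _ s] dim by (simp add: mult_mat_vec2_zero_iff z_def sum2 algebra_simps)
    then have "z = 0\<^sub>v 2" using AB(2) by (auto simp: inj2_def z_def)
    then have "z $ a = 0" using a by simp
    then show ?thesis using a by (simp add: z_def)
  qed
  have "W j a b = 0" if ab: "a < 2" "b < 2" for a b
  proof -
    define z where "z = vec 2 (\<lambda>b. W j a b)"
    have "B *\<^sub>v z = 0\<^sub>v (dim_row B)"
      using inner[OF _ ab(1)] dim by (simp add: mult_mat_vec2_zero_iff z_def sum2)
    then have "z = 0\<^sub>v 2" using AB(3) by (auto simp: inj2_def z_def)
    then have "z $ b = 0" using ab by simp
    then show ?thesis using ab by (simp add: z_def)
  qed
  then show False using nz[OF j(1)] by blast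
qed

text \<open>On leaves with kernel direction \<open>z\<close>, the first qubit of each vector is
  contracted to a vector \<open>y j\<close>. If no \<open>y j\<close> vanished, each could be
  detected while the other two are annihilated. In C^2 this is impossible: detecting
  \<open>y 0\<close> makes \<open>y 1\<close> and \<open>y 2\<close> parallel, so \<open>y 1\<close>
  cannot be separated from \<open>y 2\<close>.\<close>

lemma unambiguous_ray:
  assumes un: "unambiguous S W" and ray: "ray_split S z" and z: "z \<in> carrier_vec 2" "z \<noteq> 0\<^sub>v 2"
  shows "\<exists>j<3. \<forall>b<2. z $ 0 * W j 1 b = z $ 1 * W j 0 b"
proof (rule ccontr)
  define y where "y j = vec 2 (\<lambda>b. z $ 0 * W j 1 b - z $ 1 * W j 0 b)" for j
  have y: "y j \<in> carrier_vec 2" for j by (simp add: y_def)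
  assume neg: "\<not> ?thesis"
  have y0: "y j \<noteq> 0\<^sub>v 2" if "j < 3" for j
  proof
    assume "y j = 0\<^sub>v 2"
    then have "y j $ b = 0" if "b < 2" for b using that by simp
    then show False using neg \<open>j < 3\<close> by (auto simp: y_def)
  qed
  have sep: "\<exists>B. dim_col B = 2 \<and> B *\<^sub>v y j \<noteq> 0\<^sub>v (dim_row B) \<and> (\<forall>k<3. k \<noteq> j \<longrightarrow> B *\<^sub>v y k = 0\<^sub>v (dim_row B))"
    if j: "j < 3" for j
  proof -
    obtain A B x where AB: "(A, B) \<in> S" "A *\<^sub>v z = 0\<^sub>v (dim_row A)" "B *\<^sub>v y j \<noteq> 0\<^sub>v (dim_row B)"
      and x: "x \<in> carrier_vec 2" "A *\<^sub>v x \<noteq> 0\<^sub>v (dim_row A)"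
      using ray y[of j] y0[OF j] unfolding ray_split_def by blast
    have dim: "dim_col A = 2" "dim_col B = 2" using un AB by (auto simp: unambiguous_def)
    obtain i where i: "\<And>k r s. k < 3 \<Longrightarrow> k \<noteq> i \<Longrightarrow> r < dim_row A \<Longrightarrow> s < dim_row B \<Longrightarrow>
       (\<Sum>a<2. \<Sum>b<2. A $$ (r,a) * B $$ (s,b) * W k a b) = 0"
      using unambiguousD[OF un AB(1)] by meson
    obtain r where r: "r < dim_row A" "A $$ (r,0) * x $ 0 + A $$ (r,1) * x $ 1 \<noteq> 0"
      using x dim by (auto simp: mult_mat_vec2_zero_iff)
    \<comment> \<open>The double conjugates turn this bilinear relation into the sesquilinear form
      of \<open>perp_parallel\<close>.\<close>
    have "cnj (cnj (z $ 0)) * A $$ (r,0) + cnj (cnj (z $ 1)) * A $$ (r,1) = 0"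
      using AB(2) dim z r(1) by (simp add: mult_mat_vec2_zero_iff algebra_simps)
    moreover have "cnj (z $ 0) \<noteq> 0 \<or> cnj (z $ 1) \<noteq> 0" using vec2_eqI[OF z(1), of "0\<^sub>v 2"] z(2) by auto
    ultimately have "\<exists>t. A $$ (r,0) = - (t * cnj (cnj (z $ 1))) \<and> A $$ (r,1) = t * cnj (cnj (z $ 0))"
      by (intro perp_parallel)
    then obtain t where t: "A $$ (r,0) = - (t * z $ 1)" "A $$ (r,1) = t * z $ 0" by auto
    have t0: "t \<noteq> 0" using r(2) t by auto
    have zero: "B *\<^sub>v y k = 0\<^sub>v (dim_row B)" if k: "k < 3" "k \<noteq> i" for k
    proof -
      have "B $$ (s,0) * y k $ 0 + B $$ (s,1) * y k $ 1 = 0" if s: "s < dim_row B" for s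
      proof -
        have "t * (B $$ (s,0) * y k $ 0 + B $$ (s,1) * y k $ 1) = 0"
          using i[OF k r(1) s] by (simp add: y_def sum2 t algebra_simps)
        then show ?thesis using t0 by simp
      qed
      then show ?thesis using y dim by (simp add: mult_mat_vec2_zero_iff)
    qed
    \<comment> \<open>The leaf annihilates every \<open>y k\<close> except possibly that of its own
      label, and \<open>y j\<close> is not annihilated.\<close>
    then have "i = j" using AB(3) j by blast
    then show ?thesis using AB(3) dim zero by blast
  qed
  obtain B where B: "dim_col B = 2" "B *\<^sub>v y 0 \<noteq> 0\<^sub>v (dim_row B)" "B *\<^sub>v y 1 = 0\<^sub>v (dim_row B)" "B *\<^sub>v y 2 = 0\<^sub>v (dim_row B)"
    using sep[of 0] by auto
  obtain B' where B': "dim_col B' = 2" "B' *\<^sub>v y 1 \<noteq> 0\<^sub>v (dim_row B')" "B' *\<^sub>v y 2 = 0\<^sub>v (dim_row B')"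
    using sep[of 1] by auto
  obtain s where "s < dim_row B" "B $$ (s,0) * y 0 $ 0 + B $$ (s,1) * y 0 $ 1 \<noteq> 0"
    using B(1,2) y by (auto simp: mult_mat_vec2_zero_iff)
  then have s: "s < dim_row B" "B $$ (s,0) \<noteq> 0 \<or> B $$ (s,1) \<noteq> 0" by auto
  define b where "b = cnj (B $$ (s,0))"
  define b' where "b' = cnj (B $$ (s,1))"
  have b: "b \<noteq> 0 \<or> b' \<noteq> 0" using s by (simp add: b_def b'_def)
  have "\<exists>t. y j $ 0 = - (t * cnj b') \<and> y j $ 1 = t * cnj b" if "B *\<^sub>v y j = 0\<^sub>v (dim_row B)" for j
    by (rule perp_parallel[OF b]) (use that B(1) y s(1) in \<open>simp add: mult_mat_vec2_zero_iff b_def b'_def\<close>)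
  from this[OF B(3)] this[OF B(4)] obtain t t'
    where "y 1 $ 0 = - (t * cnj b')" "y 1 $ 1 = t * cnj b" "y 2 $ 0 = - (t' * cnj b')" "y 2 $ 1 = t' * cnj b"
    by blast
  then have "y 2 $ 0 * y 1 $ 1 = y 2 $ 1 * y 1 $ 0" by simp
  then obtain c where c: "y 1 = c \<cdot>\<^sub>v y 2" using parallel_vec2[OF y y y0[of 2]] by auto
  have "B' *\<^sub>v y 1 = c \<cdot>\<^sub>v (B' *\<^sub>v y 2)"
    unfolding c by (rule mult_mat_vec[of _ "dim_row B'" 2]) (use B' y in auto)
  then show False using B' by (simp add: smult_zero_vec)
qed

text \<open>Each of the two rays makes the rows of some \<open>W j\<close> linearly dependent, so
  that vector is a product.\<close>

lemma unambiguous_rank_split: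
  assumes un: "unambiguous S W" and split: "rank_split S"
    and nz: "\<And>j. j < 3 \<Longrightarrow> \<exists>a<2. \<exists>b<2. W j a b \<noteq> 0"
  shows "\<exists>j<3. \<exists>k<3. j \<noteq> k \<and> W j 0 0 * W j 1 1 = W j 0 1 * W j 1 0 \<and> W k 0 0 * W k 1 1 = W k 0 1 * W k 1 0"
proof -
  obtain z z' where z: "z \<in> carrier_vec 2" "ray_split S z" and z': "z' \<in> carrier_vec 2" "ray_split S z'"
    and d: "z $ 0 * z' $ 1 \<noteq> z $ 1 * z' $ 0" using split unfolding rank_split_def by blast
  have z0: "z \<noteq> 0\<^sub>v 2" "z' \<noteq> 0\<^sub>v 2" using d by auto
  obtain j where j: "j < 3" "\<And>b. b < 2 \<Longrightarrow> z $ 0 * W j 1 b = z $ 1 * W j 0 b"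
    using unambiguous_ray[OF un z(2,1) z0(1)] by blast
  obtain k where k: "k < 3" "\<And>b. b < 2 \<Longrightarrow> z' $ 0 * W k 1 b = z' $ 1 * W k 0 b"
    using unambiguous_ray[OF un z'(2,1) z0(2)] by blast
  have det: "W l 0 0 * W l 1 1 = W l 0 1 * W l 1 0"
    if x: "x \<in> carrier_vec 2" "x \<noteq> 0\<^sub>v 2" and e: "\<And>b. b < 2 \<Longrightarrow> x $ 0 * W l 1 b = x $ 1 * W l 0 b" for x l
  proof -
    have e01: "x $ 0 * W l 1 0 = x $ 1 * W l 0 0" "x $ 0 * W l 1 1 = x $ 1 * W l 0 1" using e by auto
    have "x $ 0 * (W l 0 0 * W l 1 1 - W l 0 1 * W l 1 0) = W l 0 0 * (x $ 0 * W l 1 1) - W l 0 1 * (x $ 0 * W l 1 0)"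
      by (simp add: algebra_simps)
    also have "\<dots> = 0" unfolding e01 by simp
    finally have 1: "x $ 0 * (W l 0 0 * W l 1 1 - W l 0 1 * W l 1 0) = 0" .
    have "x $ 1 * (W l 0 0 * W l 1 1 - W l 0 1 * W l 1 0) = W l 1 1 * (x $ 1 * W l 0 0) - W l 1 0 * (x $ 1 * W l 0 1)"
      by (simp add: algebra_simps)
    also have "\<dots> = 0" unfolding e01[symmetric] by simp
    finally have 2: "x $ 1 * (W l 0 0 * W l 1 1 - W l 0 1 * W l 1 0) = 0" .
    have "x $ 0 \<noteq> 0 \<or> x $ 1 \<noteq> 0" using vec2_eqI[OF x(1), of "0\<^sub>v 2"] x(2) by auto
    then show ?thesis using 1 2 by auto
  qed
  \<comment> \<open>Two independent row relations on the same matrix would force it to be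
    zero.\<close>
  have "j \<noteq> k"
  proof
    assume "j = k"
    have "W j 0 b = 0 \<and> W j 1 b = 0" if b: "b < 2" for b
    proof -
      have e: "z $ 0 * W j 1 b = z $ 1 * W j 0 b" "z' $ 0 * W j 1 b = z' $ 1 * W j 0 b"
        using j(2) k(2) b \<open>j = k\<close> by auto
      have "(z $ 0 * z' $ 1 - z $ 1 * z' $ 0) * W j 0 b = z $ 0 * (z' $ 1 * W j 0 b) - z' $ 0 * (z $ 1 * W j 0 b)"
        by (simp add: algebra_simps)
      also have "\<dots> = 0" unfolding e[symmetric] by simp
      finally have 1: "W j 0 b = 0" using d by simp
      have "(z $ 0 * z' $ 1 - z $ 1 * z' $ 0) * W j 1 b = z' $ 1 * (z $ 0 * W j 1 b) - z $ 1 * (z' $ 0 * W j 1 b)"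
        by (simp add: algebra_simps)
      also have "\<dots> = 0" unfolding e by simp
      finally show ?thesis using 1 d by simp
    qed
    moreover obtain a b where "a < 2" "b < 2" "W j a b \<noteq> 0" using nz[OF j(1)] by blast
    ultimately show False by (auto simp: less_2_cases_iff One_nat_def)
  qed
  then show ?thesis using j(1) k(1) det[OF z(1) z0(1) j(2)] det[OF z'(1) z0(2) k(2)] by blast
qed

lemma locc_tree_two_products:
  assumes tree: "Ls \<in> locc_tree" and un: "unambiguous (set Ls) W"
    and nz: "\<And>j. j < 3 \<Longrightarrow> \<exists>a<2. \<exists>b<2. W j a b \<noteq> 0"
  shows "\<exists>j<3. \<exists>k<3. j \<noteq> k \<and> W j 0 0 * W j 1 1 = W j 0 1 * W j 1 0 \<and> W k 0 0 * W k 1 1 = W k 0 1 * W k 1 0"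
proof -
  consider (full) A B where "(A, B) \<in> set Ls" "inj2 A" "inj2 B"
    | (fst) "rank_split (set Ls)" | (snd) "rank_split (prod.swap ` set Ls)"
    using locc_tree_split[OF tree] by blast
  then show ?thesis
  proof cases
    case full
    then show ?thesis using unambiguous_not_inj[OF un _ _ _ nz] by blast
  next
    case fst
    then show ?thesis by (rule unambiguous_rank_split[OF un _ nz])
  next
    case snd
    have "\<exists>j<3. \<exists>k<3. j \<noteq> k \<and> W j 0 0 * W j 1 1 = W j 1 0 * W j 0 1 \<and> W k 0 0 * W k 1 1 = W k 1 0 * W k 0 1"
      by (rule unambiguous_rank_split[OF unambiguous_swap[OF un] snd]) (use nz in blast)
    then show ?thesis by (simp add: mult.commute)
  qed
qed

section \<open>Rank-one refinement of a protocol\<close>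

definition leaf_index :: "(complex mat \<times> complex mat) list \<Rightarrow> (nat \<times> nat \<times> nat) set" where
  "leaf_index Ls = (SIGMA l:{..<length Ls}. {..<dim_row (fst (Ls ! l))} \<times> {..<dim_row (snd (Ls ! l))})"

text \<open>The conjugated row \<open>(r, s)\<close> of the joint Kraus operator of leaf
  \<open>l\<close>. As \<open>ip\<close> conjugates its first argument, \<open>ip\<close> with this
  vector yields the corresponding output amplitude.\<close>

fun leaf_vec :: "(complex mat \<times> complex mat) list \<Rightarrow> nat \<times> nat \<times> nat \<Rightarrow> nat \<Rightarrow> complex" where
  "leaf_vec Ls (l, r, s) i = cnj (fst (Ls ! l) $$ (r, i div 2) * snd (Ls ! l) $$ (s, i mod 2))"

lemma gram_index:
  assumes "a < dim_col A" "b < dim_col A"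
  shows "(adj A * A) $$ (a,b) = (\<Sum>r<dim_row A. cnj (A $$ (r,a)) * A $$ (r,b))"
  using assms by (simp add: adj_def scalar_prod_def atLeast0LessThan)

text \<open>The predicate \<open>P\<close> lets one computation serve both the whole protocol and a
  single outcome.\<close>

lemma leaf_effect_sum:
  assumes Ls: "Ls \<in> locc_tree" and ij: "i < 4" "j < 4"
  shows "(\<Sum>k\<in>{k\<in>leaf_index Ls. P (fst k)}. leaf_vec Ls k i * cnj (leaf_vec Ls k j))
    = (\<Sum>l\<in>{l. l < length Ls \<and> P l}. leaf_effect (Ls ! l) $$ (i,j))"
proof -
  have "{k\<in>leaf_index Ls. P (fst k)}
    = (SIGMA l:{l. l < length Ls \<and> P l}. {..<dim_row (fst (Ls ! l))} \<times> {..<dim_row (snd (Ls ! l))})"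
    by (auto simp: leaf_index_def)
  then have "(\<Sum>k\<in>{k\<in>leaf_index Ls. P (fst k)}. leaf_vec Ls k i * cnj (leaf_vec Ls k j))
    = (\<Sum>l\<in>{l. l < length Ls \<and> P l}. \<Sum>rs\<in>{..<dim_row (fst (Ls ! l))} \<times> {..<dim_row (snd (Ls ! l))}.
        leaf_vec Ls (l, rs) i * cnj (leaf_vec Ls (l, rs) j))"
    by (simp add: sum.Sigma split_def)
  also have "\<dots> = (\<Sum>l\<in>{l. l < length Ls \<and> P l}. leaf_effect (Ls ! l) $$ (i,j))"
  proof (intro sum.cong refl)
    fix l
    assume "l \<in> {l. l < length Ls \<and> P l}"
    then have "Ls ! l \<in> set Ls" by simp
    then have dim: "dim_col (fst (Ls ! l)) = 2" "dim_col (snd (Ls ! l)) = 2" using locc_tree_dims[OF Ls] by auto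
    have ij2: "i div 2 < 2" "j div 2 < 2" using ij by auto
    have "leaf_effect (Ls ! l) $$ (i,j)
      = (\<Sum>r<dim_row (fst (Ls ! l)). cnj (fst (Ls ! l) $$ (r, i div 2)) * fst (Ls ! l) $$ (r, j div 2))
      * (\<Sum>s<dim_row (snd (Ls ! l)). cnj (snd (Ls ! l) $$ (s, i mod 2)) * snd (Ls ! l) $$ (s, j mod 2))"
      using leaf_effect_index[OF dim ij] ij2 dim by (simp add: gram_index del: index_mult_mat(1))
    also have "\<dots> = (\<Sum>rs\<in>{..<dim_row (fst (Ls ! l))} \<times> {..<dim_row (snd (Ls ! l))}.
        leaf_vec Ls (l, rs) i * cnj (leaf_vec Ls (l, rs) j))"
      unfolding sum_product sum.cartesian_product by (intro sum.cong) (auto simp: mult.commute mult.left_commute)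
    finally show "(\<Sum>rs\<in>{..<dim_row (fst (Ls ! l))} \<times> {..<dim_row (snd (Ls ! l))}.
        leaf_vec Ls (l, rs) i * cnj (leaf_vec Ls (l, rs) j)) = leaf_effect (Ls ! l) $$ (i,j)" ..
  qed
  finally show ?thesis .
qed

lemma finite_leaf_index: "finite (leaf_index Ls)"
  by (simp add: leaf_index_def)

lemma resolution_leaf_vec:
  assumes Ls: "Ls \<in> locc_tree"
  shows "resolution (leaf_index Ls) (leaf_vec Ls)"
  unfolding resolution_def
proof (intro conjI allI impI finite_leaf_index)
  fix i j :: nat
  assume ij: "i < 4" "j < 4"
  have "(\<Sum>k\<in>leaf_index Ls. leaf_vec Ls k i * cnj (leaf_vec Ls k j)) = (\<Sum>l<length Ls. leaf_effect (Ls ! l) $$ (i,j))"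
    using leaf_effect_sum[OF Ls ij, of "\<lambda>_. True"] by (simp add: lessThan_def)
  also have "\<dots> = (\<Sum>L\<leftarrow>Ls. leaf_effect L $$ (i,j))"
    by (simp add: sum_list_sum_nth atLeast0LessThan)
  finally show "(\<Sum>k\<in>leaf_index Ls. leaf_vec Ls k i * cnj (leaf_vec Ls k j)) = (if i = j then 1 else 0)"
    using locc_tree_sum[OF Ls ij] by simp
qed

section \<open>Success probabilities of measurements and of refined families\<close>

lemma braket_ip: "dim_vec x = 4 \<Longrightarrow> braket x y = ip (($) x) (($) y)"
  by (simp add: braket_def ip_def)

lemma braket_mult_mat_vec:
  assumes "Q \<in> carrier_mat 4 4" "v \<in> carrier_vec 4"
  shows "braket v (Q *\<^sub>v v) = (\<Sum>r<4. \<Sum>s<4. cnj (v $ r) * Q $$ (r,s) * v $ s)"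
  using assms by (auto simp: braket_def scalar_prod_def sum_distrib_left atLeast0LessThan mult.assoc intro!: sum.cong)

lemma braket_rank_one_sum:
  assumes Q: "Q \<in> carrier_mat 4 4" and v: "v \<in> carrier_vec 4"
    and entries: "\<And>r s. r < 4 \<Longrightarrow> s < 4 \<Longrightarrow> Q $$ (r,s) = (\<Sum>k\<in>J. c k r * cnj (c k s))"
  shows "braket v (Q *\<^sub>v v) = of_real (\<Sum>k\<in>J. (cmod (ip (c k) (($) v)))\<^sup>2)"
proof -
  have "braket v (Q *\<^sub>v v) = (\<Sum>r<4. \<Sum>s<4. \<Sum>k\<in>J. (cnj (v $ r) * c k r) * (cnj (c k s) * v $ s))"
    unfolding braket_mult_mat_vec[OF Q v]
    by (intro sum.cong refl) (simp add: entries sum_distrib_left sum_distrib_right mult.assoc)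
  also have "\<dots> = (\<Sum>k\<in>J. \<Sum>r<4. \<Sum>s<4. (cnj (v $ r) * c k r) * (cnj (c k s) * v $ s))"
    by (subst (2) sum.swap, subst (1) sum.swap) (rule refl)
  also have "\<dots> = (\<Sum>k\<in>J. ip (($) v) (c k) * ip (c k) (($) v))"
    unfolding ip_def sum_product ..
  also have "\<dots> = of_real (\<Sum>k\<in>J. (cmod (ip (c k) (($) v)))\<^sup>2)"
    unfolding of_real_sum cmod_sq ip_cnj ..
  finally show ?thesis .
qed

lemma success_rank_one:
  assumes fin: "finite J" and label: "\<And>k. k \<in> J \<Longrightarrow> f k < n" and \<psi>: "\<And>i. i < n \<Longrightarrow> \<psi> i \<in> carrier_vec 4"
    and Q: "\<And>i. i < n \<Longrightarrow> Q i \<in> carrier_mat 4 4"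
    and entries: "\<And>i r s. i < n \<Longrightarrow> r < 4 \<Longrightarrow> s < 4 \<Longrightarrow> Q i $$ (r,s) = (\<Sum>k\<in>{k\<in>J. f k = i}. c k r * cnj (c k s))"
  shows "success n p \<psi> Q = guess_prob p (\<lambda>i. ($) (\<psi> i)) J c f"
proof -
  have "success n p \<psi> Q = (\<Sum>i<n. \<Sum>k\<in>{k\<in>J. f k = i}. p (f k) * (cmod (ip (c k) (($) (\<psi> (f k)))))\<^sup>2)"
    unfolding success_def
  proof (intro sum.cong refl)
    fix i
    assume "i \<in> {..<n}"
    then have "braket (\<psi> i) (Q i *\<^sub>v \<psi> i) = of_real (\<Sum>k\<in>{k\<in>J. f k = i}. (cmod (ip (c k) (($) (\<psi> i))))\<^sup>2)"
      by (intro braket_rank_one_sum) (auto simp: Q \<psi> entries)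
    then show "p i * Re (braket (\<psi> i) (Q i *\<^sub>v \<psi> i)) = (\<Sum>k\<in>{k\<in>J. f k = i}. p (f k) * (cmod (ip (c k) (($) (\<psi> (f k)))))\<^sup>2)"
      by (simp add: sum_distrib_left)
  qed
  also have "\<dots> = guess_prob p (\<lambda>i. ($) (\<psi> i)) J c f"
    unfolding guess_prob_def by (rule sum.group) (use fin label in auto)
  finally show ?thesis .
qed

lemma sum_list_upt: "(\<Sum>i\<leftarrow>[0..<n]. g i) = (\<Sum>i<n. g i)" for g :: "nat \<Rightarrow> 'a::comm_monoid_add"
  by (simp add: interv_sum_list_conv_sum_set_nat atLeast0LessThan)

text \<open>Outcome probabilities of a unit vector are nonnegative and sum to 1. The bound makes the
  set under \<open>Sup\<close> in \<open>opt_success\<close> bounded above.\<close>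

lemma success_le:
  assumes Q: "povm n Q" and p: "\<And>i. i < n \<Longrightarrow> 0 \<le> p i" and \<psi>: "\<And>i. i < n \<Longrightarrow> unit_vec 4 (\<psi> i)"
  shows "success n p \<psi> Q \<le> (\<Sum>i<n. p i)"
  unfolding success_def
proof (rule sum_mono)
  fix i
  assume "i \<in> {..<n}"
  then have i: "i < n" by simp
  have v: "\<psi> i \<in> carrier_vec 4" "braket (\<psi> i) (\<psi> i) = 1" using \<psi>[OF i] by (auto simp: unit_vec_def)
  have psd: "psd 4 (Q j)" if "j < n" for j using Q that by (simp add: povm_def)
  then have car: "Q j \<in> carrier_mat 4 4" if "j < n" for j using that by (simp add: psd_def)
  have nonneg: "0 \<le> Re (braket (\<psi> i) (Q j *\<^sub>v \<psi> i))" if "j < n" for j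
    using psd[OF that] v by (simp add: psd_def)
  have one: "(\<Sum>j<n. Q j $$ (r,s)) = 1\<^sub>m 4 $$ (r,s)" if "r < 4" "s < 4" for r s
  proof -
    have "(\<Sum>j<n. Q j $$ (r,s)) = msum 4 (map Q [0..<n]) $$ (r,s)"
      using that car by (subst msum_index) (auto simp: o_def sum_list_upt)
    then show ?thesis using Q by (simp add: povm_def)
  qed
  have "(\<Sum>j<n. braket (\<psi> i) (Q j *\<^sub>v \<psi> i)) = (\<Sum>j<n. \<Sum>r<4. \<Sum>s<4. cnj (\<psi> i $ r) * Q j $$ (r,s) * \<psi> i $ s)"
    using v car by (intro sum.cong) (auto simp: braket_mult_mat_vec)
  also have "\<dots> = (\<Sum>r<4. \<Sum>s<4. \<Sum>j<n. cnj (\<psi> i $ r) * Q j $$ (r,s) * \<psi> i $ s)"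
    by (subst sum.swap, rule sum.cong[OF refl], rule sum.swap)
  also have "\<dots> = (\<Sum>r<4. \<Sum>s<4. cnj (\<psi> i $ r) * 1\<^sub>m 4 $$ (r,s) * \<psi> i $ s)"
    by (intro sum.cong refl) (simp add: one flip: sum_distrib_left sum_distrib_right del: index_one_mat)
  also have "\<dots> = braket (\<psi> i) (1\<^sub>m 4 *\<^sub>v \<psi> i)"
    unfolding braket_mult_mat_vec[OF one_carrier_mat v(1)] ..
  also have "\<dots> = 1" using v by simp
  finally have "(\<Sum>j<n. Re (braket (\<psi> i) (Q j *\<^sub>v \<psi> i))) = 1" by (metis Re_sum one_complex.sel(1))
  moreover have "Re (braket (\<psi> i) (Q i *\<^sub>v \<psi> i)) \<le> (\<Sum>j<n. Re (braket (\<psi> i) (Q j *\<^sub>v \<psi> i)))"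
    by (rule member_le_sum) (use i nonneg in auto)
  ultimately show "p i * Re (braket (\<psi> i) (Q i *\<^sub>v \<psi> i)) \<le> p i"
    using p[OF i] by (simp add: mult_left_le)
qed

text \<open>Grouping the rank-one effects by label gives a POVM with the same success. This turns
  optimality of a measurement into the last assumption of \<open>optimal_family\<close>.\<close>

lemma guess_prob_le_opt:
  assumes res: "resolution J c" and label: "\<And>k. k \<in> J \<Longrightarrow> f k < n"
    and p: "\<And>i. i < n \<Longrightarrow> 0 \<le> p i" and \<psi>: "\<And>i. i < n \<Longrightarrow> unit_vec 4 (\<psi> i)"
  shows "guess_prob p (\<lambda>i. ($) (\<psi> i)) J c f \<le> opt_success n p \<psi>"
proof -
  have fin: "finite J" using res by (simp add: resolution_def)
  define Q where "Q i = mat 4 4 (\<lambda>(r,s). \<Sum>k\<in>{k\<in>J. f k = i}. c k r * cnj (c k s))" for i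
  have Q: "Q i \<in> carrier_mat 4 4" for i by (simp add: Q_def)
  have entries: "Q i $$ (r,s) = (\<Sum>k\<in>{k\<in>J. f k = i}. c k r * cnj (c k s))" if "r < 4" "s < 4" for i r s
    using that by (simp add: Q_def)
  have "psd 4 (Q i)" for i
    unfolding psd_def using braket_rank_one_sum[OF Q _ entries] by (auto simp: Q sum_nonneg)
  moreover have "msum 4 (map Q [0..<n]) = 1\<^sub>m 4"
  proof (rule eq_matI)
    fix r s
    assume "r < dim_row (1\<^sub>m 4)" "s < dim_col (1\<^sub>m 4)"
    then have rs: "r < 4" "s < 4" by auto
    have "msum 4 (map Q [0..<n]) $$ (r,s) = (\<Sum>i<n. Q i $$ (r,s))"
      using rs Q by (subst msum_index) (auto simp: o_def sum_list_upt)
    also have "\<dots> = (\<Sum>k\<in>J. c k r * cnj (c k s))"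
      unfolding entries[OF rs] by (rule sum.group) (use fin label in auto)
    finally show "msum 4 (map Q [0..<n]) $$ (r,s) = 1\<^sub>m 4 $$ (r,s)"
      using res rs by (simp add: resolution_def)
  next
    have "msum 4 (map Q [0..<n]) \<in> carrier_mat 4 4" by (rule msum_carrier) (auto simp: Q)
    then show "dim_row (msum 4 (map Q [0..<n])) = dim_row (1\<^sub>m 4)" "dim_col (msum 4 (map Q [0..<n])) = dim_col (1\<^sub>m 4)"
      by auto
  qed
  ultimately have povm: "povm n Q" by (simp add: povm_def)
  have "guess_prob p (\<lambda>i. ($) (\<psi> i)) J c f = success n p \<psi> Q"
    by (rule success_rank_one[symmetric, OF fin label]) (use \<psi> Q entries in \<open>auto simp: unit_vec_def\<close>)
  also have "\<dots> \<le> opt_success n p \<psi>"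
    unfolding opt_success_def
  proof (rule cSup_upper)
    show "bdd_above {success n p \<psi> Q |Q. povm n Q}"
      using success_le[OF _ p \<psi>] by (intro bdd_aboveI[of _ "\<Sum>i<n. p i"]) auto
  qed (use povm in blast)
  finally show ?thesis .
qed

lemma success_locc:
  assumes Ls: "Ls \<in> locc_tree" and f: "\<And>l. l < length Ls \<Longrightarrow> f l < n" and \<psi>: "\<And>i. i < n \<Longrightarrow> \<psi> i \<in> carrier_vec 4"
    and Q: "\<And>i. i < n \<Longrightarrow> Q i = msum 4 (map (\<lambda>l. leaf_effect (Ls ! l)) (filter (\<lambda>l. f l = i) [0..<length Ls]))"
  shows "success n p \<psi> Q = guess_prob p (\<lambda>i. ($) (\<psi> i)) (leaf_index Ls) (leaf_vec Ls) (f \<circ> fst)"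
proof (rule success_rank_one[OF finite_leaf_index])
  have car: "leaf_effect (Ls ! l) \<in> carrier_mat 4 4" if "l < length Ls" for l
    using locc_tree_dims[OF Ls nth_mem[OF that]] by (simp add: leaf_effect_def kron_def)
  then show "Q i \<in> carrier_mat 4 4" if "i < n" for i
    unfolding Q[OF that] by (intro msum_carrier) auto
  show "(f \<circ> fst) k < n" if "k \<in> leaf_index Ls" for k
    using f that by (auto simp: leaf_index_def)
  fix i r s :: nat
  assume i: "i < n" and rs: "r < 4" "s < 4"
  have "Q i $$ (r,s) = (\<Sum>l\<leftarrow>filter (\<lambda>l. f l = i) [0..<length Ls]. leaf_effect (Ls ! l) $$ (r,s))"
    unfolding Q[OF i] using rs car by (subst msum_index) (auto simp: o_def)
  also have "\<dots> = (\<Sum>l\<in>{l. l < length Ls \<and> f l = i}. leaf_effect (Ls ! l) $$ (r,s))"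
    by (subst sum_list_distinct_conv_sum_set) (auto intro!: sum.cong)
  finally show "Q i $$ (r,s) = (\<Sum>k\<in>{k\<in>leaf_index Ls. (f \<circ> fst) k = i}. leaf_vec Ls k r * cnj (leaf_vec Ls k s))"
    using leaf_effect_sum[OF Ls rs, of "\<lambda>l. f l = i"] by simp
qed (rule \<psi>)

section \<open>Contradiction from an optimal protocol\<close>

theorem theorem2:
  fixes \<alpha> \<beta> :: "nat \<Rightarrow> complex vec" and p :: "nat \<Rightarrow> real" and \<Phi> :: "complex vec"
  defines "\<psi> \<equiv> (\<lambda>l. tensor_vec (\<alpha> l) (\<beta> l))"
  assumes alpha_unit: "\<forall>l<3. unit_vec 2 (\<alpha> l)"
      and beta_unit: "\<forall>l<3. unit_vec 2 (\<beta> l)"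
      and p_pos: "\<forall>l<3. p l > 0"
      and p_sum: "(\<Sum>l<3. p l) = 1"
      and lin_indep: "\<forall>c. lincomb 3 c \<psi> = 0\<^sub>v 4 \<longrightarrow> (\<forall>l<3. c l = 0)"
      and Phi_unit: "unit_vec 4 \<Phi>"
      and span: "{v. \<exists>c. v = lincomb 3 c \<psi>} = {v \<in> carrier_vec 4. braket \<Phi> v = 0}"
      and cond: "\<forall>i<3. \<forall>j<3. \<forall>k<3. i \<noteq> j \<and> j \<noteq> k \<and> i \<noteq> k \<longrightarrow>
                 (p i)^2 * (lambda_min \<Phi>)^2 >
                 (p j)^2 * (cmod (braket (\<psi> i) (\<psi> j)))^2 + (p k)^2 * (cmod (braket (\<psi> i) (\<psi> k)))^2"
  shows "\<not> (\<exists>Q. locc_povm 3 Q \<and> success 3 p \<psi> Q = opt_success 3 p \<psi>)"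
proof
  assume "\<exists>Q. locc_povm 3 Q \<and> success 3 p \<psi> Q = opt_success 3 p \<psi>"
  then obtain Q Ls f where opt: "success 3 p \<psi> Q = opt_success 3 p \<psi>" and Ls: "Ls \<in> locc_tree"
    and f: "\<And>l. l < length Ls \<Longrightarrow> f l < 3"
    and Q: "\<And>i. i < 3 \<Longrightarrow> Q i = msum 4 (map (\<lambda>l. leaf_effect (Ls ! l)) (filter (\<lambda>l. f l = i) [0..<length Ls]))"
    unfolding locc_povm_def by blast
  define x where "x l = ($) (\<psi> l)" for l
  define \<phi> where "\<phi> = ($) \<Phi>"
  define D where "D = cmod (det4 \<phi>)"
  have dim\<Phi>: "dim_vec \<Phi> = 4" using Phi_unit by (auto simp: unit_vec_def)
  have \<phi>1: "ip \<phi> \<phi> = 1" using Phi_unit by (simp add: \<phi>_def braket_ip[symmetric] dim\<Phi> unit_vec_def)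
  have D: "0 \<le> D" "D \<le> 1 / 2" using det4_unit_le[OF \<phi>1] by (auto simp: D_def)
  note low = schmidt_low[OF D]
  \<comment> \<open>The hypothesis involves the square of the Schmidt weight while
    \<open>residual_bound\<close> is linear in the deficit; a weight in [0, 1/2] dominates its
    square.\<close>
  have lam: "(lambda_min \<Phi>)\<^sup>2 \<le> schmidt_low D"
  proof -
    have "(lambda_min \<Phi>)\<^sup>2 \<le> (schmidt_low D)\<^sup>2" using lambda_min_sq_le[OF Phi_unit] by (simp add: D_def \<phi>_def)
    also have "\<dots> \<le> schmidt_low D" using low by (simp add: power2_eq_square mult_left_le)
    finally show ?thesis .
  qed
  have ab: "\<alpha> l \<in> carrier_vec 2" "\<beta> l \<in> carrier_vec 2"
    "cnj (\<alpha> l $ 0) * \<alpha> l $ 0 + cnj (\<alpha> l $ 1) * \<alpha> l $ 1 = 1"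
    "cnj (\<beta> l $ 0) * \<beta> l $ 0 + cnj (\<beta> l $ 1) * \<beta> l $ 1 = 1" if "l < 3" for l
    using alpha_unit beta_unit that by (auto simp: unit_vec_def braket_def sum2)
  have dim\<psi>: "\<psi> l \<in> carrier_vec 4" if "l < 3" for l
    using ab[OF that] by (auto simp: \<psi>_def tensor_vec_def)
  have x_prod: "x l 0 = \<alpha> l $ 0 * \<beta> l $ 0" "x l 1 = \<alpha> l $ 0 * \<beta> l $ 1" "x l 2 = \<alpha> l $ 1 * \<beta> l $ 0" "x l 3 = \<alpha> l $ 1 * \<beta> l $ 1"
    if "l < 3" for l
    using ab[OF that] by (simp_all add: x_def \<psi>_def tensor_vec_def)
  have bk: "braket (\<psi> l) (\<psi> k) = ip (x l) (x k)" if "l < 3" for l k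
    using dim\<psi>[OF that] by (auto simp: x_def braket_ip)
  have x1: "ip (x l) (x l) = 1" if l: "l < 3" for l
  proof -
    have "ip (x l) (x l) = (cnj (\<alpha> l $ 0) * \<alpha> l $ 0 + cnj (\<alpha> l $ 1) * \<alpha> l $ 1) * (cnj (\<beta> l $ 0) * \<beta> l $ 0 + cnj (\<beta> l $ 1) * \<beta> l $ 1)"
      unfolding ip_expand x_prod[OF l] by (simp add: algebra_simps)
    then show ?thesis using ab[OF l] by simp
  qed
  have unit: "unit_vec 4 (\<psi> l)" if "l < 3" for l
    using dim\<psi>[OF that] x1[OF that] bk[OF that] by (simp add: unit_vec_def)
  have x\<phi>: "ip (x l) \<phi> = 0" if l: "l < 3" for l
  proof -
    have "\<psi> l = lincomb 3 (\<lambda>k. if k = l then 1 else 0) \<psi>"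
      using dim\<psi>[OF l] l by (intro eq_vecI) (auto simp: lincomb_def if_distrib[of "\<lambda>a. a * _"] cong: if_cong)
    then have "braket \<Phi> (\<psi> l) = 0" using span by blast
    then have "cnj (ip \<phi> (x l)) = 0" by (simp add: braket_ip dim\<Phi> x_def \<phi>_def)
    then show ?thesis by (simp add: ip_cnj)
  qed
  interpret optimal_family 3 p x "leaf_index Ls" "leaf_vec Ls" "f \<circ> fst"
  proof
    show "resolution (leaf_index Ls) (leaf_vec Ls)" by (rule resolution_leaf_vec[OF Ls])
    show "(f \<circ> fst) k < 3" if "k \<in> leaf_index Ls" for k
      using f that by (auto simp: leaf_index_def)
    show "0 < p i" if "i < 3" for i using p_pos that by simp
    show "a i = 0" if zero: "\<And>r. r < 4 \<Longrightarrow> (\<Sum>i<3. a i * x i r) = 0" and i: "i < 3" for a :: "nat \<Rightarrow> complex" and i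
    proof -
      have "lincomb 3 a \<psi> = 0\<^sub>v 4" using zero by (intro eq_vecI) (auto simp: lincomb_def x_def)
      then show ?thesis using lin_indep i by blast
    qed
    show "guess_prob p x (insert None (Some ` leaf_index Ls)) c' f' \<le> guess_prob p x (leaf_index Ls) (leaf_vec Ls) (f \<circ> fst)"
      if "resolution (insert None (Some ` leaf_index Ls)) c'" "\<And>k. k \<in> insert None (Some ` leaf_index Ls) \<Longrightarrow> f' k < 3"
      for c' :: "(nat \<times> nat \<times> nat) option \<Rightarrow> nat \<Rightarrow> complex" and f'
    proof -
      have "guess_prob p x (insert None (Some ` leaf_index Ls)) c' f' \<le> opt_success 3 p \<psi>"
        unfolding x_def[abs_def] using that p_pos unit by (intro guess_prob_le_opt) (auto simp: less_imp_le)
      also have "\<dots> = guess_prob p x (leaf_index Ls) (leaf_vec Ls) (f \<circ> fst)"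
        unfolding opt[symmetric] x_def[abs_def] by (rule success_locc[OF Ls f dim\<psi> Q])
      finally show ?thesis .
    qed
  qed
  \<comment> \<open>The hypothesis makes the right side of \<open>residual_bound\<close> smaller
    than \<open>(p m)\<^sup>2\<close> times the lower Schmidt weight.\<close>
  have big: "1 - schmidt_low D < Re (ip (w m) (w m))" if jkm: "j < 3" "k < 3" "m < 3" "j \<noteq> k" "j \<noteq> m" "k \<noteq> m" for j k m
  proof -
    have set: "{..<3} - {m} = {j, k}" using jkm by auto
    have "(p m)\<^sup>2 * (1 - Re (ip (w m) (w m))) \<le> (\<Sum>i\<in>{..<3} - {m}. (p i)\<^sup>2 * (cmod (ip (x m) (x i)))\<^sup>2)"
      by (rule residual_bound[OF x1 jkm(3)])
    also have "\<dots> = (p j)\<^sup>2 * (cmod (ip (x m) (x j)))\<^sup>2 + (p k)\<^sup>2 * (cmod (ip (x m) (x k)))\<^sup>2"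
      unfolding set using jkm by simp
    also have "\<dots> < (p m)\<^sup>2 * (lambda_min \<Phi>)\<^sup>2"
      using cond jkm bk[OF jkm(3)] by metis
    also have "\<dots> \<le> (p m)\<^sup>2 * schmidt_low D" using lam by (intro mult_left_mono) auto
    finally have "1 - Re (ip (w m) (w m)) < schmidt_low D" by (rule mult_left_less_imp_less) simp
    then show ?thesis by simp
  qed
  \<comment> \<open>The Schmidt weight is at most 1/2, so all three \<open>w m\<close> are nonzero;
    the protocol argument needs this.\<close>
  have pos: "0 < Re (ip (w m) (w m))" if m: "m < 3" for m
  proof -
    have "m = 0 \<or> m = 1 \<or> m = 2" using m by auto
    then have "1 - schmidt_low D < Re (ip (w m) (w m))" using big[of 1 2 0] big[of 0 2 1] big[of 0 1 2] by auto
    then show ?thesis using low by simp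
  qed
  define W where "W j a b = w j (2 * a + b)" for j a b
  have nz: "\<exists>a<2. \<exists>b<2. W j a b \<noteq> 0" if "j < 3" for j
  proof (rule ccontr)
    assume "\<not> ?thesis"
    then have "W j 0 0 = 0" "W j 0 1 = 0" "W j 1 0 = 0" "W j 1 1 = 0" by auto
    then have "ip (w j) (w j) = 0" by (simp add: ip_expand W_def)
    then show False using pos[OF that] by simp
  qed
  have un: "unambiguous (set Ls) W"
    unfolding unambiguous_def
  proof (intro ballI)
    fix L
    assume "L \<in> set Ls"
    then obtain l where l: "l < length Ls" "Ls ! l = L" by (auto simp: in_set_conv_nth)
    obtain A B where L: "L = (A, B)" by (cases L)
    have dim: "dim_col A = 2 \<and> dim_col B = 2" using locc_tree_dims[OF Ls \<open>L \<in> set Ls\<close>] L by simp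
    have "(\<Sum>a<2. \<Sum>b<2. A $$ (r,a) * B $$ (s,b) * W j a b) = 0"
      if j: "j < 3" "j \<noteq> f l" and rs: "r < dim_row A" "s < dim_row B" for j r s
    proof -
      have k: "(l, r, s) \<in> leaf_index Ls" using l L rs by (auto simp: leaf_index_def)
      have "(\<Sum>a<2. \<Sum>b<2. A $$ (r,a) * B $$ (s,b) * W j a b) = cnj (ip (w j) (leaf_vec Ls (l, r, s)))"
        using l L by (simp add: ip_expand sum2 W_def algebra_simps)
      also have "\<dots> = 0" using ip_w_c[OF k j(1)] j(2) by simp
      finally show ?thesis .
    qed
    then show "case L of (A, B) \<Rightarrow> dim_col A = 2 \<and> dim_col B = 2 \<and> (\<exists>i<3. \<forall>j<3. j \<noteq> i \<longrightarrow>
       (\<forall>r<dim_row A. \<forall>s<dim_row B. (\<Sum>a<2. \<Sum>b<2. A $$ (r,a) * B $$ (s,b) * W j a b) = 0))"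
      using f[OF l(1)] dim L by auto
  qed
  obtain j k where jk: "j < 3" "k < 3" "j \<noteq> k"
    and dets: "W j 0 0 * W j 1 1 = W j 0 1 * W j 1 0" "W k 0 0 * W k 1 1 = W k 0 1 * W k 1 0"
    using locc_tree_two_products[OF Ls un nz] by blast
  have "\<exists>m<3. m \<noteq> j \<and> m \<noteq> k" for j k :: nat by presburger
  then obtain m where m: "m < 3" "m \<noteq> j" "m \<noteq> k" by blast
  have d0: "det4 (w j) = 0" "det4 (w k) = 0" using dets by (auto simp: det4_def W_def)
  define t where "t = Re (ip (w m) (w m))"
  have wm: "ip (w m) (w m) = of_real t" unfolding t_def by (rule ip_self_real)
  \<comment> \<open>\<open>w m\<close> and \<open>\<phi>\<close> are orthogonal to each other and to
    the product vectors \<open>w j\<close> and \<open>w k\<close>.\<close>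
  have "cmod (det4 (w m)) * Re (ip \<phi> \<phi>) = cmod (det4 \<phi>) * Re (ip (w m) (w m))"
  proof (rule det4_orthogonal_complement[OF d0])
    show "ip (w j) (w j) \<noteq> 0" "ip (w k) (w k) \<noteq> 0" using pos jk by fastforce+
    show "ip (w j) (w k) = 0" "ip (w j) (w m) = 0" "ip (w k) (w m) = 0"
      using ip_w_w jk m by auto
    show "ip (w j) \<phi> = 0" "ip (w k) \<phi> = 0" "ip (w m) \<phi> = 0"
      using ip_w_perp[OF x\<phi>] jk m by auto
  qed
  then have "cmod (det4 (w m)) = t * D" by (simp add: \<phi>1 t_def D_def)
  moreover have "ip (x m) (w m) = of_real t" using ip_w_w[OF m(1) m(1)] wm by simp
  moreover have "0 < t" using pos[OF m(1)] by (simp add: t_def)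
  \<comment> \<open>The squared norm of \<open>w m\<close> equals its overlap with the product state
    \<open>x m\<close>, the situation of \<open>product_overlap_le\<close>; this contradicts
    \<open>big\<close>.\<close>
  ultimately have "t \<le> 1 - schmidt_low D"
    using product_overlap_le[OF x_prod[OF m(1)] ab(3,4)[OF m(1)] wm _ _ _ D] by blast
  moreover have "1 - schmidt_low D < t" using big[of j k m] jk m by (simp add: t_def)
  ultimately show False by simp
qed

end
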